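(* Let $J$ be a set of prime numbers, let $\Gamma=\Gamma_J$ be the group defined in the context, and let $G$ be any group. Then the $\Gamma$-radical $T_\Gamma G$ coincides with the maximal normal $H\mathbb{Z}[J^{-1}]$-perfect subgroup of $G$. Moreover, $S_\Gamma G = T_\Gamma G$, so that the $\Gamma$-nullification $P_\Gamma G$ is isomorphic to the quotient $G/S_\Gamma G$.
   Context: $\mathbb{Z}[J^{-1}]\subseteq\mathbb{Q}$ is the subring of the rationals obtained by inverting all primes in $J$. A group $G$ is $H\mathbb{Z}[J^{-1}]$-perfect if $H_1(G;\mathbb{Z}[J^{-1}])\cong G^{\mathrm{ab}}\otimes\mathbb{Z}[J^{-1}]=0$. Group nullification. Let $E$ and $G$ be groups. The $E$-socle $S_E G$ is the normal subgroup of $G$ generated by the images of all homomorphisms $E\to G$. The $E$-radical $T_E G$ is the normal subgroup of $G$ such that $G/T_EG$ is the largest quotient of $G$ with $\mathrm{Hom}(E,G/T_EG)$ trivial (it is obtained by iterating, possibly transfinitely, the operation of dividing out the $E$-socle). The $E$-nullification of $G$ is $P_EG=G/T_EG$. The group $\Gamma_J$. Let $\mathbb{N}(J)$ be the set of positive integers that are products of powers of primes in $J$ (including $1$). A pair of sequences $(\underline r,\underline n)$ is given by the following choices, made layer by layer. In layer $0$ there is one index, $0$; choose $r(0)\in\mathbb{N}(J)$ and an integer $n(0)\ge 0$. The indices of layer $1$ are $(1,i_1)$ with $1\le i_1\le 2n(0)$. For $k\geq 1$ and every index $(k,i_1,\dots,i_k)$ of layer $k$, choose $r(k,i_1,\dots,i_k)\in\mathbb{N}(J)$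 and an integer $n(k,i_1,\dots,i_k)\ge 0$; the indices of layer $k+1$ are all $(k+1,i_1,\dots,i_k,i_{k+1})$ with $(k,i_1,\dots,i_k)$ an index of layer $k$ and $1\le i_{k+1}\le 2n(k,i_1,\dots,i_k)$. (The procedure may stop, if all the $n$'s of some layer are $0$, or continue forever.) The group $G(\underline r,\underline n)$ is given by the presentation with one generator $x(0)$, respectively $x(k,i_1,\dots,i_k)$, for each index, and one relation for each index: $$x(0)^{r(0)}\prod_{i=1}^{n(0)}[x(1,2i-1),x(1,2i)]=1,$$ $$x(k,i_1,\dots,i_k)^{r(k,i_1,\dots,i_k)}\prod_{i=1}^{n(k,i_1,\dots,i_k)}[x(k+1,i_1,\dots,i_k,2i-1),x(k+1,i_1,\dots,i_k,2i)]=1 .$$ The group $\Gamma=\Gamma_J$ is the free product of the groups $G(\underline r,\underline n)$ over all possible choices of $(\underline r,\underline n)$. *)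

theory Defs
  imports "HOL-Algebra.Algebra" "HOL-Library.FuncSet"
begin

section \<open>Groups of words: free groups and free products\<close>

text \<open>
  The quotient of the free monoid on the alphabet \<open>L\<close> by the congruence generated by the pairs
  \<open>R\<close>; its elements are congruence classes of words.  The pairs in \<open>R\<close> are supposed to consist
  of words over \<open>L\<close>, so that the class of a word over \<open>L\<close> consists of words over \<open>L\<close>.
\<close>

inductive word_cong :: "('l list \<times> 'l list) set \<Rightarrow> 'l list \<Rightarrow> 'l list \<Rightarrow> bool"
  for R where
  refl: "word_cong R w w"
| sym: "word_cong R v w \<Longrightarrow> word_cong R w v"
| trans: "word_cong R u v \<Longrightarrow> word_cong R v w \<Longrightarrow> word_cong R u w"
| step: "(u, v) \<in> R \<Longrightarrow> word_cong R (xs @ u @ ys) (xs @ v @ ys)"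

definition word_rel :: "('l list \<times> 'l list) set \<Rightarrow> ('l list \<times> 'l list) set" where
  "word_rel R = {(v, w). word_cong R v w}"

definition presented_monoid :: "'l set \<Rightarrow> ('l list \<times> 'l list) set \<Rightarrow> 'l list set monoid" where
  "presented_monoid L R =
     \<lparr>carrier = lists L // word_rel R,
      monoid.mult = (\<lambda>A B. \<Union>a\<in>A. \<Union>b\<in>B. word_rel R `` {a @ b}),
      one = word_rel R `` {[]}\<rparr>"

text \<open>The letter \<open>(True, s)\<close> stands for the generator \<open>s\<close> and \<open>(False, s)\<close> for its inverse.\<close>

definition free_cancel :: "'s set \<Rightarrow> ((bool \<times> 's) list \<times> (bool \<times> 's) list) set" where
  "free_cancel S = {([(b, s), (\<not> b, s)], []) | b s. s \<in> S}"

definition free_group :: "'s set \<Rightarrow> (bool \<times> 's) list set monoid" where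
  "free_group S = presented_monoid (UNIV \<times> S) (free_cancel S)"

definition free_gen :: "'s set \<Rightarrow> 's \<Rightarrow> (bool \<times> 's) list set" where
  "free_gen S s = word_rel (free_cancel S) `` {[(True, s)]}"

text \<open>The letter \<open>(i, g)\<close> stands for the element \<open>g\<close> of the \<open>i\<close>-th factor.\<close>

definition free_product_rels ::
    "'i set \<Rightarrow> ('i \<Rightarrow> ('a, 'b) monoid_scheme) \<Rightarrow> (('i \<times> 'a) list \<times> ('i \<times> 'a) list) set" where
  "free_product_rels I G =
     {([(i, \<one>\<^bsub>G i\<^esub>)], []) | i. i \<in> I} \<union>
     {([(i, g), (i, h)], [(i, g \<otimes>\<^bsub>G i\<^esub> h)]) | i g h.
        i \<in> I \<and> g \<in> carrier (G i) \<and> h \<in> carrier (G i)}"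

definition free_product ::
    "'i set \<Rightarrow> ('i \<Rightarrow> ('a, 'b) monoid_scheme) \<Rightarrow> ('i \<times> 'a) list set monoid" where
  "free_product I G = presented_monoid (SIGMA i:I. carrier (G i)) (free_product_rels I G)"

definition normal_closure :: "('a, 'b) monoid_scheme \<Rightarrow> 'a set \<Rightarrow> 'a set" where
  "normal_closure G A = \<Inter>{N. N \<lhd> G \<and> A \<subseteq> N}"

definition group_presentation ::
    "'s set \<Rightarrow> (bool \<times> 's) list set set \<Rightarrow> (bool \<times> 's) list set set monoid" where
  "group_presentation S rels = free_group S Mod normal_closure (free_group S) rels"


section \<open>Socle, radical and nullification\<close>

definition socle :: "('e, 'f) monoid_scheme \<Rightarrow> ('a, 'b) monoid_scheme \<Rightarrow> 'a set" where
  "socle E G = normal_closure G (\<Union>h\<in>hom E G. h ` carrier E)"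

definition trivial_hom :: "('e, 'f) monoid_scheme \<Rightarrow> ('a, 'b) monoid_scheme \<Rightarrow> bool" where
  "trivial_hom E H \<longleftrightarrow> (\<forall>h\<in>hom E H. trivial_homomorphism E H h)"

text \<open>
  \<open>G Mod T\<close> is the largest quotient admitting only trivial homomorphisms from \<open>E\<close>: every other
  such quotient \<open>G Mod N\<close> is a quotient of \<open>G Mod T\<close>, i.e. \<open>T \<subseteq> N\<close>.
\<close>

definition is_radical :: "('e, 'f) monoid_scheme \<Rightarrow> ('a, 'b) monoid_scheme \<Rightarrow> 'a set \<Rightarrow> bool" where
  "is_radical E G T \<longleftrightarrow>
     T \<lhd> G \<and> trivial_hom E (G Mod T) \<and>
     (\<forall>N. N \<lhd> G \<and> trivial_hom E (G Mod N) \<longrightarrow> T \<subseteq> N)"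

lemma is_radical_unique: "is_radical E G T \<Longrightarrow> is_radical E G T' \<Longrightarrow> T = T'"
  unfolding is_radical_def by blast

lemma is_radical_exists:
  fixes G (structure)
  assumes "group G"
  shows "\<exists>T. is_radical E G T"
proof -
  interpret group G by fact
  define \<N> where "\<N> = {N. N \<lhd> G \<and> trivial_hom E (G Mod N)}"
  define T where "T = \<Inter>\<N>"
  have "carrier G \<lhd> G"
    by (intro normal_invI subgroup_self m_closed inv_closed)
  have top: "carrier G \<in> \<N>"
  proof -
    have triv: "A = carrier G" if A: "A \<in> carrier (G Mod carrier G)" for A
    proof -
      from A obtain a where a: "a \<in> carrier G" "A = carrier G #> a"
        unfolding carrier_FactGroup by (rule imageE)
      show ?thesis unfolding a(2) by (rule coset_join2[OF a(1) subgroup_self a(1)])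
    qed
    have "h x = \<one>\<^bsub>G Mod carrier G\<^esub>"
      if "h \<in> hom E (G Mod carrier G)" "x \<in> carrier E" for h x
      unfolding one_FactGroup by (rule triv[OF hom_in_carrier[OF that]])
    then show ?thesis
      using \<open>carrier G \<lhd> G\<close>
      unfolding \<N>_def trivial_hom_def trivial_homomorphism_def by simp
  qed
  have sub: "subgroup T G"
    unfolding T_def using top by (intro subgroups_Inter) (auto simp: \<N>_def normal_imp_subgroup)
  have T: "T \<lhd> G"
  proof (rule normal_invI[OF sub])
    fix x h assume "x \<in> carrier G" "h \<in> T"
    then show "x \<otimes> h \<otimes> inv x \<in> T"
      unfolding T_def \<N>_def using normal.inv_op_closed2 by fastforce
  qed
  interpret T: normal T G by fact
  have "trivial_homomorphism E (G Mod T) h" if h: "h \<in> hom E (G Mod T)" for h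
    unfolding trivial_homomorphism_def
  proof (intro conjI ballI h)
    fix x assume x: "x \<in> carrier E"
    have rep: "\<exists>g\<in>carrier G. h y = T #> g" if "y \<in> carrier E" for y
      using h that by (fastforce simp: hom_def FactGroup_def RCOSETS_def)
    obtain g where g: "g \<in> carrier G" "h x = T #> g"
      using rep x by blast
    have "g \<in> N" if N: "N \<in> \<N>" for N
    proof -
      interpret N: normal N G using N by (simp add: \<N>_def)
      have TN: "T \<subseteq> N" using N by (auto simp: T_def)
      have NT: "N <#> T = N"
      proof
        show "N <#> T \<subseteq> N" using TN by (auto simp: set_mult_def)
        show "N \<subseteq> N <#> T"
        proof
          fix z assume z: "z \<in> N"
          then have "z = z \<otimes> \<one>" by simp
          then show "z \<in> N <#> T" using z T.one_closed unfolding set_mult_def by blast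
        qed
      qed
      have coset: "N <#> (T #> a) = N #> a" if "a \<in> carrier G" for a
        using that NT setmult_rcos_assoc[OF N.subset T.subset that] by simp
      have "(\<lambda>y. N <#> h y) \<in> hom E (G Mod N)"
      proof (rule homI)
        fix y assume "y \<in> carrier E"
        then show "N <#> h y \<in> carrier (G Mod N)"
          using rep[of y] coset by (auto simp: FactGroup_def RCOSETS_def)
      next
        fix y z assume yz: "y \<in> carrier E" "z \<in> carrier E"
        obtain a where a: "a \<in> carrier G" "h y = T #> a"
          using rep[OF yz(1)] by (rule bexE)
        obtain b where b: "b \<in> carrier G" "h z = T #> b"
          using rep[OF yz(2)] by (rule bexE)
        have "h (y \<otimes>\<^bsub>E\<^esub> z) = T #> (a \<otimes> b)"
          unfolding hom_mult[OF h yz] a(2) b(2) mult_FactGroup by (rule T.rcos_sum[OF a(1) b(1)])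
        then have "N <#> h (y \<otimes>\<^bsub>E\<^esub> z) = N #> (a \<otimes> b)"
          using coset[OF m_closed[OF a(1) b(1)]] by (rule ssubst)
        also have "\<dots> = (N <#> h y) <#> (N <#> h z)"
          unfolding a(2) b(2) coset[OF a(1)] coset[OF b(1)]
          by (rule N.rcos_sum[OF a(1) b(1), symmetric])
        finally show "N <#> h (y \<otimes>\<^bsub>E\<^esub> z) = (N <#> h y) \<otimes>\<^bsub>G Mod N\<^esub> (N <#> h z)"
          unfolding mult_FactGroup .
      qed
      moreover have "trivial_hom E (G Mod N)" using N by (simp add: \<N>_def)
      ultimately have "trivial_homomorphism E (G Mod N) (\<lambda>y. N <#> h y)"
        unfolding trivial_hom_def by (rule bspec[rotated])
      then have "N <#> h x = N"
        using x by (simp add: trivial_homomorphism_def)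
      then have "N #> g = N" unfolding g(2) coset[OF g(1)] .
      then show "g \<in> N" by (rule coset_join1[OF _ g(1) N.subgroup_axioms])
    qed
    then have "g \<in> T" by (auto simp: T_def)
    then show "h x = \<one>\<^bsub>G Mod T\<^esub>"
      using g coset_join2[OF _ sub] by (simp add: FactGroup_def)
  qed
  then have "is_radical E G T"
    using T by (auto simp: is_radical_def trivial_hom_def T_def \<N>_def)
  then show ?thesis ..
qed

definition radical :: "('e, 'f) monoid_scheme \<Rightarrow> ('a, 'b) monoid_scheme \<Rightarrow> 'a set" where
  "radical E G = (THE T. is_radical E G T)"

lemma is_radical_radical: "group G \<Longrightarrow> is_radical E G (radical E G)"
  unfolding radical_def by (metis is_radical_exists is_radical_unique theI)

definition nullification ::
    "('e, 'f) monoid_scheme \<Rightarrow> ('a, 'b) monoid_scheme \<Rightarrow> 'a set monoid" where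
  "nullification E G = G Mod radical E G"


section \<open>Perfect groups with coefficients\<close>

definition J_numbers :: "nat set \<Rightarrow> nat set" where
  "J_numbers J = {\<Prod>p\<in>P. p ^ e p | P e. finite P \<and> P \<subseteq> J}"

text \<open>The additive group of the subring of the rationals obtained by inverting the primes in \<open>J\<close>.\<close>

definition Z_inv :: "nat set \<Rightarrow> rat monoid" where
  "Z_inv J = \<lparr>carrier = {of_int a / of_nat m | a m. m \<in> J_numbers J},
              monoid.mult = (+), one = 0\<rparr>"

definition abelianization :: "('a, 'b) monoid_scheme \<Rightarrow> 'a set monoid" where
  "abelianization G = G Mod derived G (carrier G)"

text \<open>
  The tensor product over the integers of two multiplicatively written abelian groups: the free
  abelian group on the pairs \<open>(a, b)\<close> modulo the bilinearity relations.
\<close>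

definition tensor_rels ::
    "('a, 'c) monoid_scheme \<Rightarrow> ('b, 'd) monoid_scheme \<Rightarrow> ('a \<times> 'b \<Rightarrow>\<^sub>0 int) set" where
  "tensor_rels A B =
     {frag_of (a \<otimes>\<^bsub>A\<^esub> a', b) - frag_of (a, b) - frag_of (a', b) | a a' b.
        a \<in> carrier A \<and> a' \<in> carrier A \<and> b \<in> carrier B} \<union>
     {frag_of (a, b \<otimes>\<^bsub>B\<^esub> b') - frag_of (a, b) - frag_of (a, b') | a b b'.
        a \<in> carrier A \<and> b \<in> carrier B \<and> b' \<in> carrier B}"

definition tensor ::
    "('a, 'c) monoid_scheme \<Rightarrow> ('b, 'd) monoid_scheme \<Rightarrow> ('a \<times> 'b \<Rightarrow>\<^sub>0 int) set monoid" where
  "tensor A B =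
     (let F = free_Abelian_group (carrier A \<times> carrier B)
      in F Mod generate F (tensor_rels A B))"

definition H1_Z_inv :: "nat set \<Rightarrow> ('a, 'b) monoid_scheme \<Rightarrow> ('a set \<times> rat \<Rightarrow>\<^sub>0 int) set monoid" where
  "H1_Z_inv J G = tensor (abelianization G) (Z_inv J)"

definition HZ_perfect :: "nat set \<Rightarrow> ('a, 'b) monoid_scheme \<Rightarrow> bool" where
  "HZ_perfect J G \<longleftrightarrow> trivial_group (H1_Z_inv J G)"

definition is_maximal_normal_HZ_perfect ::
    "nat set \<Rightarrow> ('a, 'b) monoid_scheme \<Rightarrow> 'a set \<Rightarrow> bool" where
  "is_maximal_normal_HZ_perfect J G T \<longleftrightarrow>
     T \<lhd> G \<and> HZ_perfect J (G\<lparr>carrier := T\<rparr>) \<and>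
     (\<forall>N. N \<lhd> G \<and> HZ_perfect J (G\<lparr>carrier := N\<rparr>) \<longrightarrow> N \<subseteq> T)"


section \<open>The group \<open>\<Gamma>\<close>\<close>

text \<open>
  The index \<open>(k, i\<^sub>1, \<dots>, i\<^sub>k)\<close> is encoded as the list \<open>[i\<^sub>1, \<dots>, i\<^sub>k]\<close>; its layer is its length,
  and the index \<open>0\<close> of layer 0 is the empty list.
\<close>

inductive_set indices :: "(nat list \<Rightarrow> nat) \<Rightarrow> nat list set"
  for n where
  root: "[] \<in> indices n"
| child: "is \<in> indices n \<Longrightarrow> 1 \<le> i \<Longrightarrow> i \<le> 2 * n is \<Longrightarrow> is @ [i] \<in> indices n"

text \<open>
  Extensionality makes \<open>r\<close> and \<open>n\<close> carry no information outside the actual indices, so that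
  distinct pairs of functions are distinct choices and each choice contributes one free factor.
\<close>

definition choices :: "nat set \<Rightarrow> ((nat list \<Rightarrow> nat) \<times> (nat list \<Rightarrow> nat)) set" where
  "choices J = {(r, n). r \<in> (indices n \<rightarrow>\<^sub>E J_numbers J) \<and> n \<in> extensional (indices n)}"

definition commutator :: "('a, 'b) monoid_scheme \<Rightarrow> 'a \<Rightarrow> 'a \<Rightarrow> 'a" where
  "commutator G a b = a \<otimes>\<^bsub>G\<^esub> b \<otimes>\<^bsub>G\<^esub> inv\<^bsub>G\<^esub> a \<otimes>\<^bsub>G\<^esub> inv\<^bsub>G\<^esub> b"

definition relator ::
    "(nat list \<Rightarrow> nat) \<Rightarrow> (nat list \<Rightarrow> nat) \<Rightarrow> nat list \<Rightarrow> (bool \<times> nat list) list set" where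
  "relator r n is =
     (let F = free_group (indices n); x = free_gen (indices n) in
      x is [^]\<^bsub>F\<^esub> r is \<otimes>\<^bsub>F\<^esub>
      foldr (\<otimes>\<^bsub>F\<^esub>)
        (map (\<lambda>i. commutator F (x (is @ [2 * i - 1])) (x (is @ [2 * i]))) [1..<Suc (n is)]) \<one>\<^bsub>F\<^esub>)"

definition G_rn ::
    "(nat list \<Rightarrow> nat) \<Rightarrow> (nat list \<Rightarrow> nat) \<Rightarrow> (bool \<times> nat list) list set set monoid" where
  "G_rn r n = group_presentation (indices n) (relator r n ` indices n)"

definition Gamma ::
    "nat set \<Rightarrow> (((nat list \<Rightarrow> nat) \<times> (nat list \<Rightarrow> nat)) \<times> (bool \<times> nat list) list set set) list set monoid"
  where "Gamma J = free_product (choices J) (\<lambda>(r, n). G_rn r n)"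

end

theory Submission
  imports Defs
begin

text \<open>
  A normal subgroup \<open>N\<close> is \<open>HZ[J\<^sup>-\<^sup>1]\<close>-perfect iff every \<open>x \<in> N\<close> has a power \<open>x\<^sup>r\<close>, with \<open>r\<close> a product of
  primes of \<open>J\<close>, that is a product of commutators of \<open>N\<close>.  Writing down such a product and repeating
  this for each of the elements that occur in it, layer by layer, yields exactly the data of a
  homomorphism \<open>G(r, n) \<rightarrow> N\<close> with \<open>x\<close> in its image; hence \<open>N\<close> lies in the socle.  Conversely, the
  relations of \<open>G(r, n)\<close> make the images of its generators torsion in the abelianization of the
  socle \<open>S\<close> of \<open>G\<close>, so \<open>S\<close> itself is perfect.  Finally, perfect groups are closed under extensions; so
  the preimage in \<open>G\<close> of the socle of \<open>G / S\<close> is perfect, hence contained in \<open>S\<close>, and \<open>G / S\<close> has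
  trivial socle.
\<close>

section \<open>Presented monoids, free groups and free products\<close>

lemma word_cong_append:
  assumes "word_cong R a a'" "word_cong R b b'"
  shows "word_cong R (a @ b) (a' @ b')"
proof -
  have left: "word_cong R (xs @ v) (xs @ w)" if "word_cong R v w" for xs v w
    using that
  proof (induction rule: word_cong.induct)
    case (step u v ys zs)
    then show ?case using word_cong.step[of u v R "xs @ ys" zs] by simp
  qed (auto intro: word_cong.intros)
  have right: "word_cong R (v @ xs) (w @ xs)" if "word_cong R v w" for xs v w
    using that
  proof (induction rule: word_cong.induct)
    case (step u v ys zs)
    then show ?case using word_cong.step[of u v R ys "zs @ xs"] by simp
  qed (auto intro: word_cong.intros)
  show ?thesis
    using left right assms word_cong.trans by metis
qed

lemma equiv_word_rel: "equiv UNIV (word_rel R)"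
  by (rule equivI)
    (auto simp: word_rel_def refl_on_def sym_def trans_def intro: word_cong.intros)

definition word_class :: "('l list \<times> 'l list) set \<Rightarrow> 'l list \<Rightarrow> 'l list set" where
  "word_class R w = word_rel R `` {w}"

lemma word_class_eq_iff: "word_class R v = word_class R w \<longleftrightarrow> word_cong R v w"
  using equiv_class_eq_iff[OF equiv_word_rel] by (fastforce simp: word_class_def word_rel_def)

lemma carrier_presented_monoid: "carrier (presented_monoid L R) = word_class R ` lists L"
  by (auto simp: presented_monoid_def quotient_def word_class_def)

lemma one_presented_monoid: "\<one>\<^bsub>presented_monoid L R\<^esub> = word_class R []"
  by (simp add: presented_monoid_def word_class_def)

text \<open>The product is a union over all pairs of representatives. Since the congruence is
  compatible with \<open>@\<close>, every class in that union is the same, so the union collapses to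
  one class.\<close>

lemma mult_presented_monoid:
  "word_class R a \<otimes>\<^bsub>presented_monoid L R\<^esub> word_class R b = word_class R (a @ b)"
proof -
  have "word_rel R `` {a' @ b'} = word_class R (a @ b)"
    if "a' \<in> word_class R a" "b' \<in> word_class R b" for a' b'
  proof -
    have "word_cong R (a' @ b') (a @ b)"
      using that by (auto simp: word_class_def word_rel_def intro: word_cong_append word_cong.sym)
    then show ?thesis
      using word_class_eq_iff by (metis word_class_def)
  qed
  moreover have "a \<in> word_class R a" "b \<in> word_class R b"
    by (auto simp: word_class_def word_rel_def intro: word_cong.refl)
  ultimately show ?thesis
    unfolding presented_monoid_def by auto
qed

lemma monoid_presented_monoid: "monoid (presented_monoid L R)"
  by (rule monoidI)
    (auto simp: carrier_presented_monoid one_presented_monoid mult_presented_monoid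
      simp del: in_lists_conv_set intro!: imageI)

section \<open>Evaluation of words and the universal property\<close>

definition (in monoid) word_value :: "('l \<Rightarrow> 'a) \<Rightarrow> 'l list \<Rightarrow> 'a" where
  "word_value f w = foldr (\<otimes>) (map f w) \<one>"

lemma (in monoid) word_value_simps [simp]:
  "word_value f [] = \<one>" "word_value f (x # xs) = f x \<otimes> word_value f xs"
  by (simp_all add: word_value_def)

lemma (in monoid) word_value_closed:
  assumes "f \<in> L \<rightarrow> carrier G" "w \<in> lists L"
  shows "word_value f w \<in> carrier G"
  using assms(2) by (induction w) (use assms(1) in auto)

lemma (in monoid) word_value_append:
  assumes "f \<in> L \<rightarrow> carrier G" "v \<in> lists L" "w \<in> lists L"
  shows "word_value f (v @ w) = word_value f v \<otimes> word_value f w"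
  using assms(2)
proof (induction v)
  case (Cons x v)
  then have "f x \<in> carrier G" "word_value f v \<in> carrier G" "word_value f w \<in> carrier G"
    using assms word_value_closed[OF assms(1)] by auto
  then show ?case using Cons by (simp add: m_assoc)
qed (use word_value_closed[OF assms(1,3)] in simp)

text \<open>Membership in \<open>lists L\<close> has to be carried through the induction together
  with the equality of values: in the transitivity case the intermediate word must be known to lie
  over \<open>L\<close> before both induction hypotheses can be used.\<close>

lemma (in monoid) word_value_cong:
  assumes f: "f \<in> L \<rightarrow> carrier G" and R: "R \<subseteq> lists L \<times> lists L"
    and rel: "\<And>u v. (u, v) \<in> R \<Longrightarrow> word_value f u = word_value f v"
    and "word_cong R v w"
  shows "(v \<in> lists L \<longleftrightarrow> w \<in> lists L) \<and> (v \<in> lists L \<longrightarrow> word_value f v = word_value f w)"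
  using assms(4)
proof (induction rule: word_cong.induct)
  case (step u v xs ys)
  then have "u \<in> lists L" "v \<in> lists L" using R by auto
  then show ?case
    using rel[OF step] word_value_append[OF f] by auto
qed auto

lemma (in monoid) presented_monoid_universal:
  assumes f: "f \<in> L \<rightarrow> carrier G" and R: "R \<subseteq> lists L \<times> lists L"
    and rel: "\<And>u v. (u, v) \<in> R \<Longrightarrow> word_value f u = word_value f v"
  obtains h where "h \<in> hom (presented_monoid L R) G"
    and "\<And>w. w \<in> lists L \<Longrightarrow> h (word_class R w) = word_value f w"
proof -
  \<comment> \<open>\<open>h\<close> evaluates an arbitrary representative;
    \<open>word_value_cong\<close> shows that the choice does not matter on classes of words over
    \<open>L\<close>.\<close>
  define h where "h A = word_value f (SOME w. w \<in> A)" for A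
  have h: "h (word_class R w) = word_value f w" if "w \<in> lists L" for w
  proof -
    have "w \<in> word_class R w"
      by (simp add: word_class_def word_rel_def word_cong.refl)
    then have "(SOME v. v \<in> word_class R w) \<in> word_class R w"
      by (rule someI)
    then have "word_cong R w (SOME v. v \<in> word_class R w)"
      by (simp add: word_class_def word_rel_def)
    from word_value_cong[OF f R rel this] that show ?thesis
      by (simp add: h_def)
  qed
  have "h \<in> hom (presented_monoid L R) G"
  proof (rule homI)
    fix A B assume "A \<in> carrier (presented_monoid L R)" "B \<in> carrier (presented_monoid L R)"
    then obtain v w where vw: "v \<in> lists L" "A = word_class R v" "w \<in> lists L" "B = word_class R w"
      by (auto simp only: carrier_presented_monoid)
    then have "v @ w \<in> lists L" by simp
    with vw show "h (A \<otimes>\<^bsub>presented_monoid L R\<^esub> B) = h A \<otimes> h B" "h A \<in> carrier G"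
      by (simp_all only: mult_presented_monoid h word_value_append[OF f] word_value_closed[OF f])
  qed
  then show ?thesis using h that by blast
qed

section \<open>Free groups\<close>

lemma free_cancel_subset: "free_cancel S \<subseteq> lists (UNIV \<times> S) \<times> lists (UNIV \<times> S)"
  by (auto simp: free_cancel_def)

lemma free_gen_eq: "free_gen S s = word_class (free_cancel S) [(True, s)]"
  by (simp add: free_gen_def word_class_def)

lemma free_gen_closed: "s \<in> S \<Longrightarrow> free_gen S s \<in> carrier (free_group S)"
  by (auto simp: free_group_def carrier_presented_monoid free_gen_eq)

text \<open>With the sign \<open>b\<close> left free, the instances \<open>b\<close> and
  \<open>\<not> b\<close> give the left and the right inverse of one letter.\<close>

lemma free_group_letter_inverse:
  assumes "s \<in> S"
  shows "word_class (free_cancel S) [(\<not> b, s)] \<otimes>\<^bsub>free_group S\<^esub> word_class (free_cancel S) [(b, s)]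
    = \<one>\<^bsub>free_group S\<^esub>"
proof -
  have "([(\<not> b, s), (b, s)], []) \<in> free_cancel S"
    using assms by (cases b) (auto simp: free_cancel_def)
  from word_cong.step[OF this, of "[]" "[]"] show ?thesis
    by (simp add: free_group_def one_presented_monoid mult_presented_monoid word_class_eq_iff)
qed

text \<open>Units of a monoid are closed under products, so it suffices that each single letter is a
  unit; its inverse is the letter of opposite sign.\<close>

lemma group_free_group: "group (free_group S)"
proof -
  interpret monoid "free_group S"
    unfolding free_group_def by (rule monoid_presented_monoid)
  let ?c = "word_class (free_cancel S)"
  have cons: "?c (x # w) = ?c [x] \<otimes>\<^bsub>free_group S\<^esub> ?c w" for x w
    by (simp add: free_group_def mult_presented_monoid)
  have closed: "?c w \<in> carrier (free_group S)" if "w \<in> lists (UNIV \<times> S)" for w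
    using that by (simp add: free_group_def carrier_presented_monoid)
  have "?c w \<in> Units (free_group S)" if "w \<in> lists (UNIV \<times> S)" for w
    using that
  proof (induction w)
    case Nil
    have "?c [] = \<one>\<^bsub>free_group S\<^esub>"
      by (simp add: free_group_def one_presented_monoid)
    then show ?case by simp
  next
    case (Cons x w)
    obtain b s where x: "x = (b, s)" "s \<in> S" using Cons by auto
    have "?c [x] \<in> Units (free_group S)"
      unfolding Units_def using free_group_letter_inverse[OF x(2), of b]
        free_group_letter_inverse[OF x(2), of "\<not> b"] x
      by (auto intro!: closed bexI[of _ "?c [(\<not> b, s)]"])
    then show ?case using Cons by (subst cons) auto
  qed
  then have "carrier (free_group S) \<subseteq> Units (free_group S)"
    by (auto simp: free_group_def carrier_presented_monoid)
  then show ?thesis by unfold_locales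
qed

lemma (in group) free_group_universal:
  assumes y: "y \<in> S \<rightarrow> carrier G"
  obtains h where "h \<in> hom (free_group S) G" "\<And>s. s \<in> S \<Longrightarrow> h (free_gen S s) = y s"
proof -
  \<comment> \<open>Negative letters must go to inverses for the cancelling pairs to evaluate to the
    identity.\<close>
  define f where "f = (\<lambda>(b, s). if b then y s else inv (y s))"
  have f: "f \<in> UNIV \<times> S \<rightarrow> carrier G"
    using y by (auto simp: f_def Pi_iff)
  have rel: "word_value f u = word_value f v" if "(u, v) \<in> free_cancel S" for u v
    using that y by (auto simp: free_cancel_def f_def Pi_iff)
  obtain h where h: "h \<in> hom (presented_monoid (UNIV \<times> S) (free_cancel S)) G"
    "\<And>w. w \<in> lists (UNIV \<times> S) \<Longrightarrow> h (word_class (free_cancel S) w) = word_value f w"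
    using presented_monoid_universal[OF f free_cancel_subset rel] by blast
  show ?thesis
  proof (rule that)
    show "h \<in> hom (free_group S) G" using h(1) by (simp add: free_group_def)
    show "h (free_gen S s) = y s" if "s \<in> S" for s
      using that y by (auto simp: free_gen_eq h(2) f_def Pi_iff)
  qed
qed

text \<open>Every class is a product of letters, and a negative letter is the inverse of a
  generator. This reduces the torsion property of a whole image to that of the images of the
  generators.\<close>

lemma (in group) hom_free_group_in_subgroup:
  assumes h: "h \<in> hom (free_group S) G" and V: "subgroup V G"
    and gen: "\<And>s. s \<in> S \<Longrightarrow> h (free_gen S s) \<in> V" and g: "g \<in> carrier (free_group S)"
  shows "h g \<in> V"
proof -
  interpret F: group "free_group S" by (rule group_free_group)
  interpret h: group_hom "free_group S" G h
    using h by unfold_locales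
  let ?c = "word_class (free_cancel S)"
  have closed: "?c w \<in> carrier (free_group S)" if "w \<in> lists (UNIV \<times> S)" for w
    using that by (simp add: free_group_def carrier_presented_monoid)
  have letter: "h (?c [(b, s)]) \<in> V" if s: "s \<in> S" for b s
  proof (cases b)
    case True
    then show ?thesis using gen[OF s] by (simp add: free_gen_eq)
  next
    case False
    have "?c [(False, s)] \<otimes>\<^bsub>free_group S\<^esub> ?c [(True, s)] = \<one>\<^bsub>free_group S\<^esub>"
      using free_group_letter_inverse[OF s, of True] by simp
    then have "?c [(False, s)] = inv\<^bsub>free_group S\<^esub> ?c [(True, s)]"
      using s by (intro F.inv_equality[symmetric] closed) auto
    then show ?thesis
      using False gen[OF s] s h.hom_inv[OF closed, of "[(True, s)]"] subgroup.m_inv_closed[OF V]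
      by (simp add: free_gen_eq)
  qed
  have "h (?c w) \<in> V" if "w \<in> lists (UNIV \<times> S)" for w
    using that
  proof (induction w)
    case Nil
    have "?c [] = \<one>\<^bsub>free_group S\<^esub>"
      by (simp add: free_group_def one_presented_monoid)
    then show ?case using subgroup.one_closed[OF V] by simp
  next
    case (Cons x w)
    have "?c (x # w) = ?c [x] \<otimes>\<^bsub>free_group S\<^esub> ?c w"
      by (simp add: free_group_def mult_presented_monoid)
    moreover have "h (?c [x]) \<in> V" using Cons letter by (cases x) auto
    ultimately show ?case
      using Cons closed[of "[x]"] closed[of w] subgroup.m_closed[OF V] by auto
  qed
  then show ?thesis
    using g by (auto simp: free_group_def carrier_presented_monoid)
qed

section \<open>Normal closures\<close>

lemma (in group) normal_closure_normal:
  assumes "A \<subseteq> carrier G"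
  shows "normal_closure G A \<lhd> G"
proof (rule normal_invI)
  let ?N = "{N. N \<lhd> G \<and> A \<subseteq> N}"
  have "carrier G \<in> ?N" using assms normal_self by simp
  then show "subgroup (normal_closure G A) G"
    unfolding normal_closure_def by (intro subgroups_Inter) (auto simp: normal_imp_subgroup)
  fix x h assume "x \<in> carrier G" "h \<in> normal_closure G A"
  then show "x \<otimes> h \<otimes> inv x \<in> normal_closure G A"
    unfolding normal_closure_def using normal.inv_op_closed2 by fastforce
qed

lemma subset_normal_closure: "A \<subseteq> normal_closure G A"
  by (auto simp: normal_closure_def)

lemma normal_closure_minimal: "N \<lhd> G \<Longrightarrow> A \<subseteq> N \<Longrightarrow> normal_closure G A \<subseteq> N"
  by (auto simp: normal_closure_def)

section \<open>Free products\<close>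

lemma free_product_rels_subset:
  assumes "\<And>i. i \<in> I \<Longrightarrow> monoid (G i)"
  shows "free_product_rels I G \<subseteq> lists (SIGMA i:I. carrier (G i)) \<times> lists (SIGMA i:I. carrier (G i))"
  using assms by (auto simp: free_product_rels_def intro!: monoid.m_closed monoid.one_closed)

lemma hom_free_product_inclusion:
  assumes "i \<in> I"
  shows "(\<lambda>g. word_class (free_product_rels I G) [(i, g)]) \<in> hom (G i) (free_product I G)"
proof (rule homI)
  fix g h assume gh: "g \<in> carrier (G i)" "h \<in> carrier (G i)"
  then have "([(i, g), (i, h)], [(i, g \<otimes>\<^bsub>G i\<^esub> h)]) \<in> free_product_rels I G"
    using assms by (auto simp: free_product_rels_def)
  from word_cong.sym[OF word_cong.step[OF this, of "[]" "[]"]]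
  show "word_class (free_product_rels I G) [(i, g \<otimes>\<^bsub>G i\<^esub> h)] =
    word_class (free_product_rels I G) [(i, g)] \<otimes>\<^bsub>free_product I G\<^esub>
    word_class (free_product_rels I G) [(i, h)]"
    by (simp add: free_product_def mult_presented_monoid word_class_eq_iff)
qed (use assms in \<open>auto simp: free_product_def carrier_presented_monoid\<close>)

lemma free_product_universal:
  assumes "group H" and "\<And>i. i \<in> I \<Longrightarrow> group (G i)"
    and f: "\<And>i. i \<in> I \<Longrightarrow> f i \<in> hom (G i) H"
  obtains h where "h \<in> hom (free_product I G) H"
    and "\<And>i g. i \<in> I \<Longrightarrow> g \<in> carrier (G i) \<Longrightarrow> h (word_class (free_product_rels I G) [(i, g)]) = f i g"
proof -
  interpret H: group H by fact
  let ?f = "\<lambda>(i, g). f i g"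
  have cl: "f i g \<in> carrier H" if "i \<in> I" "g \<in> carrier (G i)" for i g
    using hom_in_carrier[OF f] that by blast
  have f': "?f \<in> (SIGMA i:I. carrier (G i)) \<rightarrow> carrier H"
    using cl by auto
  have one: "f i \<one>\<^bsub>G i\<^esub> = \<one>\<^bsub>H\<^esub>" if "i \<in> I" for i
    using hom_one[OF f] that assms by blast
  have rel: "H.word_value ?f u = H.word_value ?f v" if "(u, v) \<in> free_product_rels I G" for u v
    using that by (auto simp: free_product_rels_def one cl hom_mult[OF f])
  have sub: "free_product_rels I G \<subseteq> lists (SIGMA i:I. carrier (G i)) \<times> lists (SIGMA i:I. carrier (G i))"
    by (rule free_product_rels_subset) (simp add: assms group.is_monoid)
  obtain h where h: "h \<in> hom (presented_monoid (SIGMA i:I. carrier (G i)) (free_product_rels I G)) H"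
    "\<And>w. w \<in> lists (SIGMA i:I. carrier (G i)) \<Longrightarrow>
      h (word_class (free_product_rels I G) w) = H.word_value ?f w"
    using H.presented_monoid_universal[OF f' sub rel] by blast
  show ?thesis
  proof (rule that)
    show "h \<in> hom (free_product I G) H" using h(1) by (simp add: free_product_def)
    show "h (word_class (free_product_rels I G) [(i, g)]) = f i g"
      if "i \<in> I" "g \<in> carrier (G i)" for i g
      using that cl by (simp add: h(2))
  qed
qed

lemma (in group) hom_free_product_in_subgroup:
  assumes h: "h \<in> hom (free_product I K) G" and V: "subgroup V G"
    and letter: "\<And>i g. i \<in> I \<Longrightarrow> g \<in> carrier (K i) \<Longrightarrow>
      h (word_class (free_product_rels I K) [(i, g)]) \<in> V"
    and g: "g \<in> carrier (free_product I K)"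
  shows "h g \<in> V"
proof -
  let ?c = "word_class (free_product_rels I K)" and ?L = "SIGMA i:I. carrier (K i)"
  have closed: "?c w \<in> carrier (free_product I K)" if "w \<in> lists ?L" for w
    using that by (simp add: free_product_def carrier_presented_monoid)
  have mult: "?c (v @ w) = ?c v \<otimes>\<^bsub>free_product I K\<^esub> ?c w" for v w
    by (simp add: free_product_def mult_presented_monoid)
  have "h (?c w) \<in> V" if "w \<in> lists ?L" for w
    using that
  proof (induction w)
    case Nil
    \<comment> \<open>The free product is not known to be a group here, so \<open>hom_one\<close> is
      out of reach. Instead, the image of the empty word is an idempotent of the group
      \<open>G\<close>, hence the identity.\<close>
    have "h (?c []) = h (?c []) \<otimes> h (?c [])"
      using hom_mult[OF h closed closed, of "[]" "[]"] mult[of "[]" "[]"] by simp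
    then have "h (?c []) = \<one>"
      using hom_in_carrier[OF h closed, of "[]"] by simp
    then show ?case using subgroup.one_closed[OF V] by simp
  next
    case (Cons x w)
    have "h (?c [x]) \<in> V" using Cons letter by (cases x) auto
    then show ?case
      using Cons hom_mult[OF h closed closed, of "[x]" w] mult[of "[x]" w] subgroup.m_closed[OF V]
      by auto
  qed
  then show ?thesis
    using g by (auto simp: free_product_def carrier_presented_monoid)
qed


section \<open>Perfectness as torsion of the abelianization\<close>

lemma one_in_J_numbers: "1 \<in> J_numbers J"
  unfolding J_numbers_def by (rule CollectI, rule exI[of _ "{}"]) auto

lemma J_numbers_mult:
  assumes "a \<in> J_numbers J" "b \<in> J_numbers J"
  shows "a * b \<in> J_numbers J"
proof -
  obtain P e where P: "finite P" "P \<subseteq> J" "a = (\<Prod>p\<in>P. p ^ e p)"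
    using assms(1) by (auto simp: J_numbers_def)
  obtain Q f where Q: "finite Q" "Q \<subseteq> J" "b = (\<Prod>p\<in>Q. p ^ f p)"
    using assms(2) by (auto simp: J_numbers_def)
  \<comment> \<open>Both products are extended to the union of the two index sets with exponent 0 at
    the new places; then the exponents add up.\<close>
  define k where "k p = (if p \<in> P then e p else 0) + (if p \<in> Q then f p else 0)" for p
  have "a = (\<Prod>p\<in>P \<union> Q. p ^ (if p \<in> P then e p else 0))"
    unfolding P(3) using P(1) Q(1) by (intro prod.mono_neutral_cong_left) auto
  moreover have "b = (\<Prod>p\<in>P \<union> Q. p ^ (if p \<in> Q then f p else 0))"
    unfolding Q(3) using P(1) Q(1) by (intro prod.mono_neutral_cong_left) auto
  ultimately have "a * b = (\<Prod>p\<in>P \<union> Q. p ^ k p)"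
    by (simp add: k_def power_add prod.distrib)
  then show ?thesis
    unfolding J_numbers_def using P Q by blast
qed

lemma J_numbers_pos:
  assumes "\<forall>p\<in>J. Factorial_Ring.prime p" "m \<in> J_numbers J"
  shows "m > 0"
  using assms unfolding J_numbers_def by (fastforce intro!: prod_pos dest: prime_gt_0_nat)

lemma (in normal) trivial_FactGroup_iff: "trivial_group (G Mod H) \<longleftrightarrow> carrier G \<subseteq> H"
proof -
  have "trivial_group (G Mod H) \<longleftrightarrow> (\<forall>x\<in>carrier G. H #> x = H)"
    unfolding trivial_group_def using factorgroup_is_group one_closed coset_mult_one[OF subset]
    by (auto simp: carrier_FactGroup image_iff intro!: bexI[of _ \<one>])
  also have "\<dots> \<longleftrightarrow> carrier G \<subseteq> H"
    using coset_join1[OF _ _ subgroup_axioms] coset_join2[OF _ subgroup_axioms] by blast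
  finally show ?thesis .
qed

section \<open>The additive group of Z[J^-1] and tensor products with it\<close>

lemma carrier_Z_inv: "q \<in> carrier (Z_inv J) \<longleftrightarrow> (\<exists>a. \<exists>m\<in>J_numbers J. q = of_int a / of_nat m)"
  by (auto simp: Z_inv_def)

lemma mult_Z_inv [simp]: "x \<otimes>\<^bsub>Z_inv J\<^esub> y = x + y" and one_Z_inv [simp]: "\<one>\<^bsub>Z_inv J\<^esub> = 0"
  by (simp_all add: Z_inv_def)

lemma of_int_in_Z_inv: "of_int a \<in> carrier (Z_inv J)"
  unfolding carrier_Z_inv using one_in_J_numbers by (intro exI bexI[of _ 1]) auto

lemma nat_multiple_in_Z_inv: "q \<in> carrier (Z_inv J) \<Longrightarrow> of_nat n * q \<in> carrier (Z_inv J)"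
  unfolding carrier_Z_inv by (metis of_int_mult of_int_of_nat_eq times_divide_eq_right)

lemma Z_inv_divide:
  assumes "q \<in> carrier (Z_inv J)" "r \<in> J_numbers J"
  shows "q / of_nat r \<in> carrier (Z_inv J)"
  using assms unfolding carrier_Z_inv
  by (metis J_numbers_mult divide_divide_eq_left of_nat_mult)

text \<open>Write (x) for the tensor sign. If \<open>a [^] r = \<one>\<close>, then a (x) b = a^r
  (x) b/r = 0. Conversely, a derivation of a (x) 1 = 0 uses finitely many relations, and a suitable
  power map to \<open>G\<close> turns it into a proof that some \<open>a [^] M\<close> is
  trivial.\<close>

lemma (in comm_group) trivial_tensor_iff:
  assumes J: "\<forall>p\<in>J. Factorial_Ring.prime p"
  shows "trivial_group (tensor G (Z_inv J)) \<longleftrightarrow> (\<forall>a\<in>carrier G. \<exists>r\<in>J_numbers J. a [^] r = \<one>)"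
proof -
  let ?Z = "carrier (Z_inv J)"
  define F where "F = free_Abelian_group (carrier G \<times> ?Z)"
  let ?R = "tensor_rels G (Z_inv J)"
  define K where "K = generate F ?R"
  interpret F: comm_group F
    unfolding F_def by (rule abelian_free_Abelian_group)
  have add_Z: "b + b' \<in> ?Z" if bb': "b \<in> ?Z" "b' \<in> ?Z" for b b'
  proof -
    obtain c m d k where b: "m \<in> J_numbers J" "b = of_int c / of_nat m" "k \<in> J_numbers J"
      "b' = of_int d / of_nat k"
      using bb' unfolding carrier_Z_inv by metis
    then have "b + b' = of_int (c * int k + d * int m) / of_nat (m * k)"
      using J_numbers_pos[OF J b(1)] J_numbers_pos[OF J b(3)] by (simp add: field_simps)
    then show ?thesis
      using J_numbers_mult[OF b(1,3)] carrier_Z_inv by blast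
  qed
  have R: "?R \<subseteq> carrier F"
  proof
    fix x assume "x \<in> ?R"
    then have "\<exists>u v w. x = frag_of u - frag_of v - frag_of w \<and>
        u \<in> carrier G \<times> ?Z \<and> v \<in> carrier G \<times> ?Z \<and> w \<in> carrier G \<times> ?Z"
      unfolding tensor_rels_def using add_Z by fastforce
    then obtain u v w where x: "x = frag_of u - frag_of v - frag_of w"
      "u \<in> carrier G \<times> ?Z" "v \<in> carrier G \<times> ?Z" "w \<in> carrier G \<times> ?Z" by blast
    have "Poly_Mapping.keys x \<subseteq> carrier G \<times> ?Z"
      unfolding x(1) by (intro order.trans[OF keys_diff] Un_least) (use x in auto)
    then show "x \<in> carrier F"
      by (simp add: F_def)
  qed
  have K: "subgroup K F"
    unfolding K_def by (rule F.generate_is_subgroup[OF R])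
  then interpret K: normal K F
    by (rule F.subgroup_imp_normal)
  have K_add: "x + y \<in> K" if "x \<in> K" "y \<in> K" for x y
    using K.m_closed[OF that] by (simp add: F_def)
  have K_minus: "- x \<in> K" if "x \<in> K" for x
    using K.m_inv_closed[OF that] K.subset that by (auto simp: F_def subset_iff)
  have K_zero: "0 \<in> K"
    using K.one_closed by (simp add: F_def)
  have K_diff: "x - y \<in> K" if "x \<in> K" "y \<in> K" for x y
    using K_add[OF that(1) K_minus[OF that(2)]] by simp
  have rel1: "frag_of (a \<otimes> a', b) - frag_of (a, b) - frag_of (a', b) \<in> K"
    if "a \<in> carrier G" "a' \<in> carrier G" "b \<in> ?Z" for a a' b
    unfolding K_def using that by (intro generate.incl) (auto simp: tensor_rels_def)
  have rel2: "frag_of (a, b + b') - frag_of (a, b) - frag_of (a, b') \<in> K"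
    if "a \<in> carrier G" "b \<in> ?Z" "b' \<in> ?Z" for a b b'
    unfolding K_def using that by (intro generate.incl) (auto simp: tensor_rels_def)
  \<comment> \<open>With both first entries equal to \<open>\<one>\<close> the bilinearity relation
    collapses to \<open>- frag_of (\<one>, b)\<close>. The next fact uses the same trick in the
    second argument.\<close>
  have one_K: "frag_of (\<one>, b) \<in> K" if "b \<in> ?Z" for b
    using K_minus[OF rel1[OF one_closed one_closed that]] by simp
  have zero_K: "frag_of (a, 0) \<in> K" if "a \<in> carrier G" for a
    using K_minus[OF rel2[OF that, of 0 0]] of_int_in_Z_inv[of 0] by simp
  have move: "frag_of (a, of_nat n * b) - frag_of (a [^] n, b) \<in> K"
    if "a \<in> carrier G" "b \<in> ?Z" for a b and n :: nat
  proof (induction n)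
    case 0
    show ?case using K_diff[OF zero_K one_K] that by simp
  next
    case (Suc n)
    \<comment> \<open>\<open>?u\<close> and \<open>?v\<close> are the bilinearity relations in the
      second and in the first argument that lead from \<open>n\<close> to
      \<open>Suc n\<close>.\<close>
    let ?u = "frag_of (a, of_nat n * b + b) - frag_of (a, of_nat n * b) - frag_of (a, b)"
    let ?v = "frag_of (a [^] n \<otimes> a, b) - frag_of (a [^] n, b) - frag_of (a, b)"
    have "frag_of (a, of_nat (Suc n) * b) - frag_of (a [^] Suc n, b)
      = ?u + (frag_of (a, of_nat n * b) - frag_of (a [^] n, b)) - ?v"
      by (simp add: algebra_simps)
    also have "\<dots> \<in> K"
      using that by (intro K_diff K_add Suc rel1 rel2 nat_multiple_in_Z_inv) auto
    finally show ?case .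
  qed
  have "trivial_group (tensor G (Z_inv J)) \<longleftrightarrow> carrier F \<subseteq> K"
    using K.trivial_FactGroup_iff by (simp add: tensor_def F_def K_def Let_def)
  also have "\<dots> \<longleftrightarrow> (\<forall>a\<in>carrier G. \<exists>r\<in>J_numbers J. a [^] r = \<one>)"
  proof
    assume tors: "\<forall>a\<in>carrier G. \<exists>r\<in>J_numbers J. a [^] r = \<one>"
    show "carrier F \<subseteq> K"
    proof
      fix x assume "x \<in> carrier F"
      then have "Poly_Mapping.keys x \<subseteq> carrier G \<times> ?Z" by (simp add: F_def)
      then show "x \<in> K"
      proof (rule free_Abelian_group_induct)
        fix ab assume "ab \<in> carrier G \<times> ?Z"
        then obtain a b where ab: "ab = (a, b)" "a \<in> carrier G" "b \<in> ?Z" by auto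
        obtain r where r: "r \<in> J_numbers J" "a [^] r = \<one>" using tors ab by blast
        have b': "b / of_nat r \<in> ?Z" using Z_inv_divide ab r by blast
        have "of_nat r * (b / of_nat r) = b" using J_numbers_pos[OF J r(1)] by simp
        with K_add[OF move[OF ab(2) b', of r] one_K[OF b']] show "frag_of ab \<in> K"
          using r ab by simp
      qed (auto intro: K_diff K_zero)
    qed
  next
    assume FK: "carrier F \<subseteq> K"
    \<comment> \<open>The floor makes the exponent an integer for every \<open>b\<close>. It changes
      nothing when \<open>m\<close> is a multiple of the denominator of \<open>b\<close>, and only
      then is additivity in \<open>b\<close> to be expected.\<close>
    define \<phi> :: "nat \<Rightarrow> 'a \<times> rat \<Rightarrow> 'a" where "\<phi> m = (\<lambda>(a, b). a [^] \<lfloor>of_nat m * b\<rfloor>)" for m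
    have "\<exists>h. h \<in> hom F G \<and> (\<forall>ab\<in>carrier G \<times> ?Z. h (frag_of ab) = \<phi> m ab)" for m
    proof -
      have "\<phi> m ` (carrier G \<times> ?Z) \<subseteq> carrier G" by (auto simp: \<phi>_def)
      then show ?thesis
        unfolding F_def by (rule free_Abelian_group_universal) blast
    qed
    then obtain h where h: "\<And>m. h m \<in> hom F G"
      "\<And>m a b. a \<in> carrier G \<Longrightarrow> b \<in> ?Z \<Longrightarrow> h m (frag_of (a, b)) = a [^] \<lfloor>of_nat m * b\<rfloor>"
      unfolding \<phi>_def by (metis (no_types, lifting) SigmaI case_prod_conv)
    have hh: "group_hom F G (h m)" for m
      using h(1) by unfold_locales
    have h_diff: "h m (frag_of u - frag_of v - frag_of w) = \<one>"
      if "h m (frag_of u) = h m (frag_of v) \<otimes> h m (frag_of w)"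
        and "u \<in> carrier G \<times> ?Z" "v \<in> carrier G \<times> ?Z" "w \<in> carrier G \<times> ?Z" for m u v w
    proof -
      interpret h: group_hom F G "h m" by (rule hh)
      have "frag_of u - frag_of v - frag_of w =
        frag_of u \<otimes>\<^bsub>F\<^esub> inv\<^bsub>F\<^esub> frag_of v \<otimes>\<^bsub>F\<^esub> inv\<^bsub>F\<^esub> frag_of w"
        using that by (simp add: F_def)
      moreover have F: "frag_of u \<in> carrier F" "frag_of v \<in> carrier F" "frag_of w \<in> carrier F"
        using that by (auto simp: F_def)
      ultimately have "h m (frag_of u - frag_of v - frag_of w) =
          h m (frag_of w) \<otimes> h m (frag_of v) \<otimes> inv h m (frag_of v) \<otimes> inv h m (frag_of w)"
        using that(1) by (simp add: m_comm)
      then show ?thesis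
        using F by (simp add: m_assoc)
    qed
    \<comment> \<open>Only finitely many relations occur, so a common denominator \<open>M\<close> of their rational entries
      turns \<open>(a, b) \<mapsto> a\<^bsup>M b\<^esup>\<close> into a map that respects all of them.\<close>
    have killed_rel: "\<exists>M\<in>J_numbers J. \<forall>k. h (M * k) x = \<one>" if "x \<in> ?R" for x
    proof -
      have int: "\<lfloor>of_nat (c * m * k) * (of_int d / of_nat m :: rat)\<rfloor> = int (c * k) * d"
        if "m \<in> J_numbers J" for c m k d
      proof -
        have "of_nat (c * m * k) * (of_int d / of_nat m :: rat) = of_int (int (c * k) * d)"
          using J_numbers_pos[OF J that] by (simp add: field_simps)
        then show ?thesis by (simp only: floor_of_int)
      qed
      from that consider (left) a a' b where "a \<in> carrier G" "a' \<in> carrier G" "b \<in> ?Z"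
          "x = frag_of (a \<otimes> a', b) - frag_of (a, b) - frag_of (a', b)"
        | (right) a b b' where "a \<in> carrier G" "b \<in> ?Z" "b' \<in> ?Z"
          "x = frag_of (a, b + b') - frag_of (a, b) - frag_of (a, b')"
        unfolding tensor_rels_def mult_Z_inv by blast
      then show ?thesis
      proof cases
        case left
        \<comment> \<open>A relation in the first argument is respected by every \<open>h m\<close>:
          its three exponents agree, and powers distribute over products in a commutative
          group.\<close>
        have "h (1 * k) x = \<one>" for k
          unfolding left(4) by (rule h_diff) (use left in \<open>simp_all add: h(2) int_pow_distrib\<close>)
        then show ?thesis using one_in_J_numbers by blast
      next
        case right
        obtain c m where b: "m \<in> J_numbers J" "b = of_int c / of_nat m"
          using right unfolding carrier_Z_inv by metis
        obtain d k where b': "k \<in> J_numbers J" "b' = of_int d / of_nat k"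
          using right unfolding carrier_Z_inv by metis
        have "h (m * k * l) x = \<one>" for l
        proof -
          have e: "\<lfloor>of_nat (m * k * l) * b\<rfloor> = int (k * l) * c" "\<lfloor>of_nat (m * k * l) * b'\<rfloor> = int (m * l) * d"
            using int[OF b(1), of k l c] int[OF b'(1), of m l d] b b' by (simp_all add: mult_ac)
          \<comment> \<open>The first summand is an integer, so \<open>int_add_floor\<close> can
            split the floor of the sum.\<close>
          have s: "of_nat (m * k * l) * b = of_int (int (k * l) * c)"
            using J_numbers_pos[OF J b(1)] b by (simp add: field_simps)
          have "\<lfloor>of_nat (m * k * l) * (b + b')\<rfloor> = int (k * l) * c + int (m * l) * d"
            unfolding distrib_left s e(2)[symmetric] by (rule int_add_floor[symmetric])
          then have "h (m * k * l) (frag_of (a, b + b')) =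
              h (m * k * l) (frag_of (a, b)) \<otimes> h (m * k * l) (frag_of (a, b'))"
            using right add_Z by (simp only: h(2) e int_pow_mult)
          then show ?thesis
            unfolding right(4) by (rule h_diff) (use right add_Z in auto)
        qed
        then show ?thesis using J_numbers_mult[OF b(1) b'(1)] by blast
      qed
    qed
    \<comment> \<open>Asking for all multiples of \<open>M\<close> is what makes the induction work:
      for a product of two elements, \<open>M * M'\<close> is a multiple of both
      multipliers.\<close>
    have killed: "\<exists>M\<in>J_numbers J. \<forall>k. h (M * k) x = \<one>" if "x \<in> K" for x
      using that unfolding K_def
    proof (induction rule: generate.induct)
      case one
      show ?case using group_hom.hom_one[OF hh] one_in_J_numbers by blast
    next
      case (incl x)
      then show ?case by (rule killed_rel)
    next
      case (inv x)
      then have "x \<in> carrier F" using R by blast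
      then show ?case
        using killed_rel[OF inv] group_hom.hom_inv[OF hh] by (metis inv_one)
    next
      case (eng x y)
      then obtain M M' where M: "M \<in> J_numbers J" "\<And>k. h (M * k) x = \<one>"
        "M' \<in> J_numbers J" "\<And>k. h (M' * k) y = \<one>" by blast
      have "x \<in> carrier F" "y \<in> carrier F"
        using eng(1,2) F.generate_in_carrier[OF R] by auto
      then have "h (M * M' * k) (x \<otimes>\<^bsub>F\<^esub> y) = \<one>" for k
        using M(2)[of "M' * k"] M(4)[of "M * k"] hom_mult[OF h(1), of x y]
        by (simp add: mult_ac)
      then show ?case using J_numbers_mult[OF M(1,3)] by blast
    qed
    show "\<forall>a\<in>carrier G. \<exists>r\<in>J_numbers J. a [^] r = \<one>"
    proof
      fix a assume a: "a \<in> carrier G"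
      have one: "1 \<in> ?Z" using of_int_in_Z_inv[of 1] by simp
      then have "frag_of (a, 1) \<in> K" using FK a by (auto simp: F_def)
      then obtain M where M: "M \<in> J_numbers J" "h (M * 1) (frag_of (a, 1)) = \<one>"
        using killed by blast
      then have "a [^] M = \<one>"
        using a one by (simp add: h(2) int_pow_int)
      then show "\<exists>r\<in>J_numbers J. a [^] r = \<one>" using M by blast
    qed
  qed
  finally show ?thesis .
qed

section \<open>Torsion modulo the derived subgroup\<close>

definition abelian_torsion :: "nat set \<Rightarrow> ('a, 'b) monoid_scheme \<Rightarrow> 'a set" where
  "abelian_torsion J G =
     {x \<in> carrier G. \<exists>r\<in>J_numbers J. x [^]\<^bsub>G\<^esub> r \<in> derived G (carrier G)}"

lemma (in group) derived_coset_eq_iff: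
  assumes "x \<in> carrier G"
  shows "derived G (carrier G) #> x = derived G (carrier G) \<longleftrightarrow> x \<in> derived G (carrier G)"
proof -
  interpret D: normal "derived G (carrier G)" G by (rule derived_self_is_normal)
  show ?thesis
    using coset_join1[OF _ assms D.subgroup_axioms]
      coset_join2[OF assms D.subgroup_axioms] by blast
qed

text \<open>\<open>abelian_torsion J G\<close> is the preimage in \<open>G\<close> of the torsion of
  the abelianization with exponents in \<open>J_numbers J\<close>, so this is the tensor criterion
  applied to that quotient and read in terms of elements instead of cosets.\<close>

lemma (in group) HZ_perfect_iff:
  assumes "\<forall>p\<in>J. Factorial_Ring.prime p"
  shows "HZ_perfect J G \<longleftrightarrow> carrier G \<subseteq> abelian_torsion J G"
proof -
  interpret D: normal "derived G (carrier G)" G by (rule derived_self_is_normal)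
  interpret Q: comm_group "G Mod derived G (carrier G)" by (rule derived_quot_is_comm_group)
  show ?thesis
    unfolding HZ_perfect_def H1_Z_inv_def abelianization_def Q.trivial_tensor_iff[OF assms]
    by (auto simp: carrier_FactGroup D.FactGroup_pow derived_coset_eq_iff abelian_torsion_def)
qed

text \<open>If \<open>r\<close> kills \<open>x\<close> and \<open>s\<close> kills \<open>y\<close>
  in the abelianization, then \<open>r * s\<close> kills both and, by commutativity there, their
  product.\<close>

lemma (in group) subgroup_abelian_torsion: "subgroup (abelian_torsion J G) G"
proof -
  let ?D = "derived G (carrier G)"
  interpret D: normal ?D G by (rule derived_self_is_normal)
  interpret Q: comm_group "G Mod ?D" by (rule derived_quot_is_comm_group)
  have iff: "x [^] r \<in> ?D \<longleftrightarrow> (?D #> x) [^]\<^bsub>G Mod ?D\<^esub> r = \<one>\<^bsub>G Mod ?D\<^esub>"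
    if "x \<in> carrier G" for x and r :: nat
    using that by (simp add: D.FactGroup_pow derived_coset_eq_iff)
  have in_Q: "?D #> x \<in> carrier (G Mod ?D)" if "x \<in> carrier G" for x
    using that by (auto simp: carrier_FactGroup)
  show ?thesis
  proof (rule subgroupI)
    show "abelian_torsion J G \<subseteq> carrier G" by (auto simp: abelian_torsion_def)
    have "\<one> [^] (1::nat) \<in> ?D" by simp
    then show "abelian_torsion J G \<noteq> {}"
      using one_in_J_numbers by (force simp: abelian_torsion_def)
  next
    fix x assume "x \<in> abelian_torsion J G"
    then obtain r where x: "x \<in> carrier G" "r \<in> J_numbers J" "x [^] r \<in> ?D"
      by (auto simp: abelian_torsion_def)
    then have "inv x [^] r \<in> ?D" by (metis D.m_inv_closed nat_pow_inv)
    then show "inv x \<in> abelian_torsion J G"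
      using x by (auto simp: abelian_torsion_def)
  next
    fix x y assume "x \<in> abelian_torsion J G" "y \<in> abelian_torsion J G"
    then obtain r s where xy: "x \<in> carrier G" "r \<in> J_numbers J" "x [^] r \<in> ?D"
      "y \<in> carrier G" "s \<in> J_numbers J" "y [^] s \<in> ?D"
      by (auto simp: abelian_torsion_def)
    let ?x = "?D #> x" and ?y = "?D #> y" and ?Q = "G Mod ?D"
    have c: "?x \<in> carrier ?Q" "?y \<in> carrier ?Q" using xy in_Q by auto
    have "?x [^]\<^bsub>?Q\<^esub> (r * s) = \<one>\<^bsub>?Q\<^esub>" "?y [^]\<^bsub>?Q\<^esub> (r * s) = \<one>\<^bsub>?Q\<^esub>"
      using xy iff[of x r] iff[of y s] Q.nat_pow_pow[OF c(1), of r s] Q.nat_pow_pow[OF c(2), of s r]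
        Q.nat_pow_one by (metis mult.commute)+
    then have "(?x \<otimes>\<^bsub>?Q\<^esub> ?y) [^]\<^bsub>?Q\<^esub> (r * s) = \<one>\<^bsub>?Q\<^esub>"
      using c by (simp only: Q.nat_pow_distrib Q.l_one Q.one_closed)
    moreover have "?x \<otimes>\<^bsub>?Q\<^esub> ?y = ?D #> (x \<otimes> y)"
      using xy by (simp add: D.rcos_sum)
    ultimately have "(x \<otimes> y) [^] (r * s) \<in> ?D"
      using xy by (simp only: iff m_closed)
    then show "x \<otimes> y \<in> abelian_torsion J G"
      using xy J_numbers_mult by (auto simp: abelian_torsion_def)
  qed
qed

lemma (in group) subgroup_abelian_torsion_iff:
  assumes "subgroup N G"
  shows "x \<in> abelian_torsion J (G\<lparr>carrier := N\<rparr>) \<longleftrightarrow>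
    x \<in> N \<and> (\<exists>r\<in>J_numbers J. x [^] r \<in> derived G N)"
  using derived_consistent[OF order.refl assms] by (auto simp: abelian_torsion_def nat_pow_consistent[symmetric])

text \<open>Powers commute with conjugation, and \<open>derived G N\<close> is normal in
  \<open>G\<close> along with \<open>N\<close>. Normality in all of \<open>G\<close> is what allows
  a comparison with the socle, which is a normal closure in \<open>G\<close>.\<close>

lemma (in group) normal_abelian_torsion:
  assumes N: "N \<lhd> G"
  shows "abelian_torsion J (G\<lparr>carrier := N\<rparr>) \<lhd> G"
proof -
  interpret N: normal N G by fact
  interpret D: normal "derived G N" G by (rule derived_is_normal[OF N])
  show ?thesis
  proof (rule normal_invI)
    show "subgroup (abelian_torsion J (G\<lparr>carrier := N\<rparr>)) G"
      using group.subgroup_abelian_torsion[OF subgroup_imp_group] N.subgroup_axioms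
        incl_subgroup by blast
    fix x h assume x: "x \<in> carrier G" and "h \<in> abelian_torsion J (G\<lparr>carrier := N\<rparr>)"
    then obtain r where h: "h \<in> N" "r \<in> J_numbers J" "h [^] r \<in> derived G N"
      using subgroup_abelian_torsion_iff[OF N.subgroup_axioms] by blast
    have hc: "h \<in> carrier G" using h(1) by (rule N.mem_carrier)
    have "(x \<otimes> h \<otimes> inv x) [^] n = x \<otimes> h [^] n \<otimes> inv x" for n :: nat
    proof (induction n)
      case (Suc n)
      have "x \<otimes> h [^] n \<otimes> inv x \<otimes> (x \<otimes> h \<otimes> inv x) = x \<otimes> (h [^] n \<otimes> h) \<otimes> inv x"
        using x hc by (simp add: m_assoc) (simp flip: m_assoc)
      then show ?case by (simp add: Suc)
    qed (use x in simp)
    then have "(x \<otimes> h \<otimes> inv x) [^] r \<in> derived G N"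
      using D.inv_op_closed2[OF x h(3)] by simp
    then show "x \<otimes> h \<otimes> inv x \<in> abelian_torsion J (G\<lparr>carrier := N\<rparr>)"
      using h N.inv_op_closed2[OF x h(1)] subgroup_abelian_torsion_iff[OF N.subgroup_axioms]
      by blast
  qed
qed


section \<open>Homomorphisms out of \<open>\<Gamma>\<close>\<close>

lemma (in monoid) word_value_fun_cong:
  assumes "\<And>x. x \<in> set w \<Longrightarrow> f x = g x"
  shows "word_value f w = word_value g w"
  using assms by (simp add: word_value_def cong: map_cong)

lemma (in group) word_value_in_subgroup:
  assumes "subgroup H G" "f \<in> L \<rightarrow> H" "w \<in> lists L"
  shows "word_value f w \<in> H"
  using assms(3) by (induction w) (use assms in \<open>auto intro: subgroup.one_closed subgroup.m_closed\<close>)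

lemma (in group_hom) hom_word_value:
  assumes "f \<in> L \<rightarrow> carrier G" "w \<in> lists L"
  shows "h (G.word_value f w) = H.word_value (\<lambda>l. h (f l)) w"
  using assms(2)
  by (induction w) (use assms(1) G.word_value_closed[OF assms(1)] in \<open>auto simp: Pi_iff\<close>)

lemma (in group) commutator_closed [simp]:
  "a \<in> carrier G \<Longrightarrow> b \<in> carrier G \<Longrightarrow> commutator G a b \<in> carrier G"
  by (simp add: commutator_def)

lemma (in group) inv_commutator:
  "a \<in> carrier G \<Longrightarrow> b \<in> carrier G \<Longrightarrow> inv (commutator G a b) = commutator G b a"
  by (simp add: commutator_def inv_mult_group m_assoc)

lemma (in group_hom) hom_commutator:
  "a \<in> carrier G \<Longrightarrow> b \<in> carrier G \<Longrightarrow> h (commutator G a b) = commutator H (h a) (h b)"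
  by (simp add: commutator_def)

lemma (in group) commutator_in_derived:
  "a \<in> N \<Longrightarrow> b \<in> N \<Longrightarrow> commutator G a b \<in> derived G N"
  unfolding derived_def by (rule generate.incl) (auto simp: commutator_def)

text \<open>Swapping the entries of a commutator inverts it, so products of commutators, without
  inverses, already exhaust the derived subgroup. This is the shape that occurs in the
  relators.\<close>

lemma (in group) derived_word_of_commutators:
  assumes N: "N \<subseteq> carrier G" and d: "d \<in> derived G N"
  shows "\<exists>ps\<in>lists (N \<times> N). d = word_value (\<lambda>(a, b). commutator G a b) ps"
proof -
  let ?c = "\<lambda>(a, b). commutator G a b"
  have c: "?c \<in> N \<times> N \<rightarrow> carrier G" using N by (auto intro!: commutator_closed)
  from d show ?thesis
    unfolding derived_def
  proof (induction rule: generate.induct)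
    case one
    show ?case by (rule bexI[of _ "[]"]) auto
  next
    case (incl h)
    then obtain a b where h: "a \<in> N" "b \<in> N" "h = commutator G a b"
      by (auto simp: commutator_def)
    then have "commutator G a b \<in> carrier G" using subsetD[OF N] by simp
    then show ?case using h by (intro bexI[of _ "[(a, b)]"]) auto
  next
    case (inv h)
    then obtain a b where h: "a \<in> N" "b \<in> N" "h = commutator G a b"
      by (auto simp: commutator_def)
    then have "commutator G b a \<in> carrier G" "inv h = commutator G b a"
      using subsetD[OF N] by (simp_all add: inv_commutator)
    then show ?case using h by (intro bexI[of _ "[(b, a)]"]) auto
  next
    case (eng h k)
    then obtain ps qs where "ps \<in> lists (N \<times> N)" "h = word_value ?c ps"
      "qs \<in> lists (N \<times> N)" "k = word_value ?c qs" by blast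
    then show ?case
      using word_value_append[OF c] by (intro bexI[of _ "ps @ qs"]) auto
  qed
qed

section \<open>Homomorphisms from presented groups and the relators\<close>

lemma (in group) hom_group_presentation:
  assumes h: "h \<in> hom (free_group S) G" and R: "R \<subseteq> carrier (free_group S)"
    and "\<And>u. u \<in> R \<Longrightarrow> h u = \<one>"
  obtains k where "k \<in> hom (group_presentation S R) G"
    "\<And>u. u \<in> carrier (free_group S) \<Longrightarrow>
      k (normal_closure (free_group S) R #>\<^bsub>free_group S\<^esub> u) = h u"
proof -
  interpret F: group "free_group S" by (rule group_free_group)
  interpret h: group_hom "free_group S" G h
    using h by unfold_locales
  have "normal_closure (free_group S) R \<subseteq> kernel (free_group S) G h"
    using assms by (intro normal_closure_minimal h.normal_kernel) (auto simp: kernel_def)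
  from h.FactGroup_universal_kernel[OF F.normal_closure_normal[OF R] this] show ?thesis
    using that unfolding group_presentation_def by blast
qed

text \<open>Brings \<open>foldr\<close> into the form \<open>word_value\<close>, for which closure
  and images under homomorphisms are available.\<close>

lemma relator_eq:
  "relator r n is = free_gen (indices n) is [^]\<^bsub>free_group (indices n)\<^esub> r is
    \<otimes>\<^bsub>free_group (indices n)\<^esub>
    monoid.word_value (free_group (indices n))
      (\<lambda>i. commutator (free_group (indices n)) (free_gen (indices n) (is @ [2 * i - 1]))
        (free_gen (indices n) (is @ [2 * i]))) [1..<Suc (n is)]"
  unfolding relator_def Let_def
    monoid.word_value_def[OF group.is_monoid[OF group_free_group]] ..

lemma children_in_indices:
  assumes "is \<in> indices n" "i \<in> {1..n is}"
  shows "is @ [2 * i - 1] \<in> indices n" "is @ [2 * i] \<in> indices n"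
  using assms by (intro indices.child; fastforce)+

lemma relator_closed:
  assumes "is \<in> indices n"
  shows "relator r n is \<in> carrier (free_group (indices n))"
proof -
  interpret F: group "free_group (indices n)" by (rule group_free_group)
  show ?thesis
    unfolding relator_eq using assms
    by (intro F.m_closed F.nat_pow_closed F.word_value_closed[where L = "{1..n is}"])
      (auto intro!: F.commutator_closed free_gen_closed children_in_indices simp del: One_nat_def)
qed

lemma (in group) hom_relator:
  assumes h: "h \<in> hom (free_group (indices n)) G" and "is": "is \<in> indices n"
  shows "h (relator r n is) = h (free_gen (indices n) is) [^] r is \<otimes>
    word_value (\<lambda>i. commutator G (h (free_gen (indices n) (is @ [2 * i - 1])))
        (h (free_gen (indices n) (is @ [2 * i])))) [1..<Suc (n is)]"
proof -
  interpret F: group "free_group (indices n)" by (rule group_free_group)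
  interpret h: group_hom "free_group (indices n)" G h
    using h by unfold_locales
  let ?x = "free_gen (indices n)"
  let ?c = "\<lambda>i. commutator (free_group (indices n)) (?x (is @ [2 * i - 1])) (?x (is @ [2 * i]))"
  have x: "?x (is @ [2 * i - 1]) \<in> carrier (free_group (indices n))"
    "?x (is @ [2 * i]) \<in> carrier (free_group (indices n))" if "i \<in> {1..n is}" for i
    using children_in_indices[OF "is" that] by (auto intro: free_gen_closed)
  have c: "?c \<in> {1..n is} \<rightarrow> carrier (free_group (indices n))"
    using x by (auto intro!: F.commutator_closed)
  have w: "[1..<Suc (n is)] \<in> lists {1..n is}" by auto
  have "h (F.word_value ?c [1..<Suc (n is)]) = word_value (\<lambda>i. h (?c i)) [1..<Suc (n is)]"
    by (rule h.hom_word_value[OF c w])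
  also have "\<dots> = word_value (\<lambda>i. commutator G (h (?x (is @ [2 * i - 1]))) (h (?x (is @ [2 * i]))))
      [1..<Suc (n is)]"
    by (intro word_value_fun_cong h.hom_commutator x) auto
  finally show ?thesis
    unfolding relator_eq
    using free_gen_closed[OF "is"] F.word_value_closed[OF c w] by (simp add: h.hom_nat_pow)
qed

section \<open>Images of \<open>Gamma J\<close> and torsion\<close>

lemma group_G_rn: "group (G_rn r n)"
proof -
  interpret F: group "free_group (indices n)" by (rule group_free_group)
  show ?thesis
    unfolding G_rn_def group_presentation_def
    by (intro normal.factorgroup_is_group F.normal_closure_normal)
      (auto intro: relator_closed)
qed

text \<open>The relation at an index expresses a power of its generator as the inverse of a product
  of commutators of other generators. The images of all of them lie in \<open>N\<close>, so the
  image of that power lies in \<open>derived G N\<close>. The torsion elements form a subgroup,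
  hence generators suffice, first for each factor and then for the free product.\<close>

lemma (in group) Gamma_hom_image_torsion:
  assumes h: "h \<in> hom (Gamma J) G" and N: "N \<lhd> G" and hN: "h ` carrier (Gamma J) \<subseteq> N"
  shows "h ` carrier (Gamma J) \<subseteq> abelian_torsion J (G\<lparr>carrier := N\<rparr>)"
proof -
  interpret N: normal N G by fact
  interpret D: normal "derived G N" G by (rule derived_is_normal[OF N])
  let ?V = "abelian_torsion J (G\<lparr>carrier := N\<rparr>)"
  let ?K = "\<lambda>(r, n). G_rn r n"
  let ?c = "word_class (free_product_rels (choices J) ?K)"
  have V: "subgroup ?V G" by (rule normal_imp_subgroup[OF normal_abelian_torsion[OF N]])
  have letter: "h (?c [(rn, g)]) \<in> ?V" if rn: "rn \<in> choices J" and g: "g \<in> carrier (?K rn)" for rn g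
  proof -
    obtain r n where rn_eq: "rn = (r, n)" by fastforce
    let ?F = "free_group (indices n)" and ?x = "free_gen (indices n)"
    let ?R = "relator r n ` indices n"
    let ?M = "normal_closure ?F ?R"
    interpret F: group ?F by (rule group_free_group)
    have M: "?M \<lhd> ?F" by (rule F.normal_closure_normal) (auto intro: relator_closed)
    interpret M: normal ?M ?F by (rule M)
    have incl: "(\<lambda>g. ?c [(rn, g)]) \<in> hom (G_rn r n) (Gamma J)"
      using hom_free_product_inclusion[OF rn, of ?K] by (simp add: Gamma_def rn_eq)
    \<comment> \<open>\<open>k\<close> is the composite of the projection from the free group to
      \<open>G_rn r n\<close>, the inclusion into \<open>Gamma J\<close> and
      \<open>h\<close>.\<close>
    define k where "k u = h (?c [(rn, ?M #>\<^bsub>?F\<^esub> u)])" for u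
    have proj: "(\<lambda>u. ?M #>\<^bsub>?F\<^esub> u) \<in> hom ?F (G_rn r n)"
      using M.r_coset_hom_Mod by (simp add: G_rn_def group_presentation_def)
    have "k = h \<circ> ((\<lambda>g. ?c [(rn, g)]) \<circ> (\<lambda>u. ?M #>\<^bsub>?F\<^esub> u))"
      by (simp add: fun_eq_iff k_def)
    then have k: "k \<in> hom ?F G"
      using Group.hom_compose[OF Group.hom_compose[OF proj incl] h] by simp
    have kN: "k u \<in> N" if "u \<in> carrier ?F" for u
      unfolding k_def using hom_in_carrier[OF incl hom_in_carrier[OF proj that]] hN by blast
    have gen: "k (?x is) \<in> ?V" if "is": "is \<in> indices n" for "is"
    proof -
      let ?W = "word_value (\<lambda>i. commutator G (k (?x (is @ [2 * i - 1]))) (k (?x (is @ [2 * i]))))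
        [1..<Suc (n is)]"
      have rel: "relator r n is \<in> ?M"
        using "is" subset_normal_closure by fast
      have "?M #>\<^bsub>?F\<^esub> relator r n is = ?M #>\<^bsub>?F\<^esub> \<one>\<^bsub>?F\<^esub>"
        using F.coset_join2[OF relator_closed[OF "is"] M.subgroup_axioms rel]
          F.coset_mult_one[OF M.subset] by simp
      then have "k (relator r n is) = k \<one>\<^bsub>?F\<^esub>" by (simp add: k_def)
      also have "\<dots> = \<one>" by (rule hom_one[OF k F.is_group is_group])
      finally have eq: "k (?x is) [^] r is \<otimes> ?W = \<one>" unfolding hom_relator[OF k "is"] .
      have W: "?W \<in> derived G N"
        using children_in_indices[OF "is"]
        by (intro word_value_in_subgroup[where L = "{1..n is}"] D.subgroup_axioms)
          (auto intro!: commutator_in_derived kN free_gen_closed)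
      have x: "k (?x is) \<in> N" by (rule kN[OF free_gen_closed[OF "is"]])
      have "k (?x is) [^] r is = inv ?W"
        using eq x W D.subset N.subset by (intro inv_equality[symmetric]) auto
      then have "k (?x is) [^] r is \<in> derived G N" using W by simp
      moreover have "r is \<in> J_numbers J"
        using rn "is" by (auto simp: choices_def rn_eq)
      ultimately show ?thesis
        using x subgroup_abelian_torsion_iff[OF N.subgroup_axioms] by blast
    qed
    obtain u where "u \<in> carrier ?F" "g = ?M #>\<^bsub>?F\<^esub> u"
      using g by (auto simp: rn_eq G_rn_def group_presentation_def carrier_FactGroup)
    then show ?thesis
      using hom_free_group_in_subgroup[OF k V gen] by (simp add: k_def)
  qed
  show ?thesis
    using hom_free_product_in_subgroup[OF h[unfolded Gamma_def] V letter] by (auto simp: Gamma_def)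
qed

lemma indices_restrict: "indices (restrict n (indices n)) = indices n"
proof
  show "indices (restrict n (indices n)) \<subseteq> indices n"
  proof
    fix xs assume "xs \<in> indices (restrict n (indices n))"
    then show "xs \<in> indices n"
      by induction (auto intro: indices.intros)
  qed
  show "indices n \<subseteq> indices (restrict n (indices n))"
  proof
    fix xs assume "xs \<in> indices n"
    then show "xs \<in> indices (restrict n (indices n))"
      by induction (auto intro: indices.intros)
  qed
qed

lemma (in group) torsion_in_Gamma_hom_image:
  assumes N: "subgroup N G" and tors: "N \<subseteq> abelian_torsion J (G\<lparr>carrier := N\<rparr>)" and x: "x \<in> N"
  shows "\<exists>h\<in>hom (Gamma J) G. x \<in> h ` carrier (Gamma J)"
proof -
  interpret N: subgroup N G by fact
  interpret D: subgroup "derived G N" G by (rule derived_is_subgroup[OF N.subset])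
  let ?c = "\<lambda>(a, b). commutator G a b"
  \<comment> \<open>The number and the list are chosen for each element \<open>z\<close> of
    \<open>N\<close>, not for each index, so that the labels can be computed along an index from the
    root label alone.\<close>
  have "\<exists>q. fst q \<in> J_numbers J \<and> snd q \<in> lists (N \<times> N) \<and>
      z [^] fst q \<otimes> word_value ?c (snd q) = \<one>"
    if z: "z \<in> N" for z
  proof -
    obtain m where m: "m \<in> J_numbers J" "z [^] m \<in> derived G N"
      using z tors subgroup_abelian_torsion_iff[OF N] by blast
    \<comment> \<open>The inverse of the power is expanded, since a relator is a power times a
      product of commutators.\<close>
    then obtain ps where ps: "ps \<in> lists (N \<times> N)" "inv (z [^] m) = word_value ?c ps"
      using derived_word_of_commutators[OF N.subset D.m_inv_closed] by blast
    have "z [^] m \<otimes> word_value ?c ps = \<one>"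
      unfolding ps(2)[symmetric] using N.mem_carrier[OF z] by simp
    then show ?thesis using m(1) ps(1) by (intro exI[of _ "(m, ps)"]) simp
  qed
  then obtain q where q: "\<forall>z\<in>N. fst (q z) \<in> J_numbers J \<and> snd (q z) \<in> lists (N \<times> N) \<and>
      z [^] fst (q z) \<otimes> word_value ?c (snd (q z)) = \<one>"
    using bchoice[of N "\<lambda>z q. fst q \<in> J_numbers J \<and> snd q \<in> lists (N \<times> N) \<and>
      z [^] fst q \<otimes> word_value ?c (snd q) = \<one>"] by blast
  define m0 where "m0 z = fst (q z)" for z
  define ps0 where "ps0 z = snd (q z)" for z
  have m0: "m0 z \<in> J_numbers J"
    and ps0: "ps0 z \<in> lists (N \<times> N)" "z [^] m0 z \<otimes> word_value ?c (ps0 z) = \<one>"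
    if "z \<in> N" for z
    using q that by (simp_all add: m0_def ps0_def)
  \<comment> \<open>The labels \<open>y\<close> of the indices: the children of \<open>is\<close> with numbers \<open>2 j - 1\<close> and \<open>2 j\<close> carry the
    two entries of the \<open>j\<close>-th commutator chosen for \<open>y is\<close>.\<close>
  define child where "child z i = (if odd i then fst else snd) (ps0 z ! ((i - 1) div 2))"
    for z and i :: nat
  define y where "y = foldl child x"
  define n0 where "n0 is = length (ps0 (y is))" for "is"
  \<comment> \<open>\<open>n0\<close> also takes values at lists that are not indices; they are cut
    off so that \<open>(r, n)\<close> is an element of \<open>choices J\<close>.\<close>
  define n where "n = restrict n0 (indices n0)"
  define r where "r = restrict (\<lambda>is. m0 (y is)) (indices n0)"
  have ind: "indices n = indices n0"
    unfolding n_def by (rule indices_restrict)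
  have yN: "y is \<in> N" if "is \<in> indices n" for "is"
    using that[unfolded ind]
  proof induction
    case root
    show ?case using x by (simp add: y_def)
  next
    case (child "is" i)
    then have "ps0 (y is) ! ((i - 1) div 2) \<in> N \<times> N"
      using ps0(1)[OF child.IH] by (auto simp: n0_def dest!: nth_mem[rotated] intro!: nth_mem)
    moreover have "y (is @ [i]) = child (y is) i" by (simp add: y_def)
    ultimately show ?case by (auto simp: child_def)
  qed
  have choice: "(r, n) \<in> choices J"
    using m0 yN unfolding choices_def ind by (auto simp: r_def n_def ind indices_restrict)
  let ?F = "free_group (indices n)" and ?x = "free_gen (indices n)"
  let ?M = "normal_closure ?F (relator r n ` indices n)"
  obtain h0 where h0: "h0 \<in> hom ?F G" "\<And>is. is \<in> indices n \<Longrightarrow> h0 (?x is) = y is"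
    using free_group_universal[of y "indices n"] yN by auto
  have rel: "h0 (relator r n is) = \<one>" if "is": "is \<in> indices n" for "is"
  proof -
    let ?l = "\<lambda>i. commutator G (h0 (?x (is @ [2 * i - 1]))) (h0 (?x (is @ [2 * i])))"
    have n_eq: "n is = length (ps0 (y is))"
      using "is"[unfolded ind] by (simp add: n_def n0_def)
    \<comment> \<open>Relators number their commutators from 1 and lists are indexed from 0, so
      position \<open>j\<close> holds commutator number \<open>Suc j\<close>.\<close>
    have "map ?l [1..<Suc (n is)] = map ?c (ps0 (y is))"
    proof (rule nth_equalityI)
      fix j assume "j < length (map ?l [1..<Suc (n is)])"
      then have j: "j < n is" by (simp del: upt_Suc)
      then have "is @ [2 * Suc j - 1] \<in> indices n" "is @ [2 * Suc j] \<in> indices n"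
        using children_in_indices[OF "is", of "Suc j"] by auto
      then have "?l (Suc j) = commutator G (y (is @ [2 * Suc j - 1])) (y (is @ [2 * Suc j]))"
        by (simp only: h0(2))
      also have "\<dots> = ?c (ps0 (y is) ! j)"
        by (simp add: y_def child_def case_prod_beta)
      finally show "map ?l [1..<Suc (n is)] ! j = map ?c (ps0 (y is)) ! j"
        using j by (simp add: n_eq del: upt_Suc)
    qed (simp add: n_eq del: upt_Suc)
    then have "word_value ?l [1..<Suc (n is)] = word_value ?c (ps0 (y is))"
      by (simp add: word_value_def)
    moreover have "r is = m0 (y is)" using "is" by (simp add: r_def ind)
    ultimately show ?thesis
      unfolding hom_relator[OF h0(1) "is"] using ps0(2)[OF yN[OF "is"]] h0(2)[OF "is"] by simp
  qed
  obtain k where k: "k \<in> hom (G_rn r n) G" "\<And>u. u \<in> carrier ?F \<Longrightarrow> k (?M #>\<^bsub>?F\<^esub> u) = h0 u"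
    using hom_group_presentation[OF h0(1), of "relator r n ` indices n"] relator_closed rel
    unfolding G_rn_def by blast
  let ?K = "\<lambda>(r, n). G_rn r n"
  \<comment> \<open>Only the factor of the constructed pair \<open>(r, n)\<close> matters; all other
    factors are sent to the identity.\<close>
  define f where "f i = (if i = (r, n) then k else (\<lambda>_. \<one>))" for i
  have f: "f i \<in> hom (?K i) G" for i
    using k(1) by (auto simp: f_def hom_def)
  have K: "group (?K i)" for i
    by (cases i) (simp add: group_G_rn)
  have "\<exists>h. h \<in> hom (Gamma J) G \<and> (\<forall>i\<in>choices J. \<forall>g\<in>carrier (?K i).
      h (word_class (free_product_rels (choices J) ?K) [(i, g)]) = f i g)"
    unfolding Gamma_def
    by (rule free_product_universal[where H = G and I = "choices J" and G = ?K and f = f])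
      (rule is_group K f | blast)+
  then obtain h where h: "h \<in> hom (Gamma J) G"
    "\<And>i g. i \<in> choices J \<Longrightarrow> g \<in> carrier (?K i) \<Longrightarrow>
      h (word_class (free_product_rels (choices J) ?K) [(i, g)]) = f i g"
    by blast
  have root: "[] \<in> indices n" by (rule indices.root)
  let ?g = "?M #>\<^bsub>?F\<^esub> ?x []"
  have g: "?g \<in> carrier (G_rn r n)"
    using free_gen_closed[OF root] by (auto simp: G_rn_def group_presentation_def carrier_FactGroup)
  have "h (word_class (free_product_rels (choices J) ?K) [((r, n), ?g)]) = x"
    using h(2)[OF choice] g k(2)[OF free_gen_closed[OF root]] h0(2)[OF root]
    by (simp add: f_def y_def)
  moreover have "word_class (free_product_rels (choices J) ?K) [((r, n), ?g)] \<in> carrier (Gamma J)"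
    using choice g by (auto simp: Gamma_def free_product_def carrier_presented_monoid)
  ultimately show ?thesis using h(1) by force
qed


section \<open>Socle and radical\<close>

text \<open>The derived subgroup of the image of \<open>P\<close> is the image of
  \<open>derived G P\<close>. So for \<open>x\<close> in \<open>P\<close> some power is a product of
  an element of \<open>H\<close> and an element of \<open>derived G P\<close>. Both are torsion
  modulo \<open>derived G P\<close>, hence so is that power, and a further power of it lies in
  \<open>derived G P\<close>.\<close>

lemma (in normal) torsion_extension:
  assumes P: "subgroup P G" "H \<subseteq> P"
    and torsH: "H \<subseteq> abelian_torsion J (G\<lparr>carrier := H\<rparr>)"
    and torsQ: "(\<lambda>x. H #> x) ` P \<subseteq> abelian_torsion J ((G Mod H)\<lparr>carrier := (\<lambda>x. H #> x) ` P\<rparr>)"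
  shows "P \<subseteq> abelian_torsion J (G\<lparr>carrier := P\<rparr>)"
proof
  let ?\<pi> = "\<lambda>x. H #> x"
  interpret P: subgroup P G by fact
  interpret DP: subgroup "derived G P" G by (rule derived_is_subgroup[OF P.subset])
  interpret Q: group "G Mod H" by (rule factorgroup_is_group)
  interpret \<pi>: group_hom G "G Mod H" ?\<pi>
    using r_coset_hom_Mod by unfold_locales
  have V: "subgroup (abelian_torsion J (G\<lparr>carrier := P\<rparr>)) G"
    using group.subgroup_abelian_torsion[OF subgroup_imp_group[OF P(1)]] incl_subgroup[OF P(1)]
    by blast
  have derV: "derived G P \<subseteq> abelian_torsion J (G\<lparr>carrier := P\<rparr>)"
  proof
    fix d assume "d \<in> derived G P"
    moreover from this have "d [^] (1::nat) \<in> derived G P" by simp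
    ultimately show "d \<in> abelian_torsion J (G\<lparr>carrier := P\<rparr>)"
      using derived_incl[OF order.refl P(1)] one_in_J_numbers[of J]
        subgroup_abelian_torsion_iff[OF P(1), of d J] by blast
  qed
  have HV: "H \<subseteq> abelian_torsion J (G\<lparr>carrier := P\<rparr>)"
  proof
    fix s assume s: "s \<in> H"
    then obtain r where "r \<in> J_numbers J" "s [^] r \<in> derived G H"
      using torsH subgroup_abelian_torsion_iff[OF subgroup_axioms, of s J] by blast
    then show "s \<in> abelian_torsion J (G\<lparr>carrier := P\<rparr>)"
      using s P(2) mono_derived[OF P(2)] subgroup_abelian_torsion_iff[OF P(1), of s J] by blast
  qed
  fix x assume x: "x \<in> P"
  have "subgroup (?\<pi> ` P) (G Mod H)" by (rule \<pi>.subgroup_img_is_subgroup[OF P(1)])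
  with x torsQ obtain r where r: "r \<in> J_numbers J"
    "?\<pi> x [^]\<^bsub>G Mod H\<^esub> r \<in> derived (G Mod H) (?\<pi> ` P)"
    using Q.subgroup_abelian_torsion_iff by blast
  then have "?\<pi> (x [^] r) \<in> ?\<pi> ` derived G P"
    using x by (simp add: FactGroup_pow \<pi>.derived_img[OF P.subset])
  then obtain d where d: "d \<in> derived G P" "?\<pi> (x [^] r) = ?\<pi> d" by blast
  have xd: "x [^] r \<in> carrier G" "d \<in> carrier G" using x d by auto
  have "x [^] r \<in> H #> d"
    unfolding d(2)[symmetric] by (rule rcos_self[OF xd(1) subgroup_axioms])
  then obtain s where "s \<in> H" "x [^] r = s \<otimes> d" by (auto simp: r_coset_def)
  then have "x [^] r \<in> abelian_torsion J (G\<lparr>carrier := P\<rparr>)"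
    using subgroup.m_closed[OF V] HV derV d(1) by auto
  then obtain q where q: "q \<in> J_numbers J" "(x [^] r) [^] q \<in> derived G P"
    using subgroup_abelian_torsion_iff[OF P(1), of "x [^] r" J] by blast
  then have "x [^] (r * q) \<in> derived G P"
    using nat_pow_pow[OF P.mem_carrier[OF x]] by simp
  then show "x \<in> abelian_torsion J (G\<lparr>carrier := P\<rparr>)"
    using x J_numbers_mult[OF r(1) q(1)] subgroup_abelian_torsion_iff[OF P(1), of x J] by blast
qed

section \<open>The socle as maximal perfect subgroup and as radical\<close>

context group
begin

lemma hom_images_subset: "(\<Union>h\<in>hom E G. h ` carrier E) \<subseteq> carrier G"
  by (auto simp: hom_def)

lemma socle_normal: "socle E G \<lhd> G"
  unfolding socle_def by (rule normal_closure_normal[OF hom_images_subset])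

lemma hom_image_subset_socle: "h \<in> hom E G \<Longrightarrow> h ` carrier E \<subseteq> socle E G"
  unfolding socle_def using subset_normal_closure by fastforce

lemma socle_minimal:
  assumes "N \<lhd> G" "\<And>h. h \<in> hom E G \<Longrightarrow> h ` carrier E \<subseteq> N"
  shows "socle E G \<subseteq> N"
  unfolding socle_def using assms by (intro normal_closure_minimal) auto

text \<open>The torsion part of the socle is normal in \<open>G\<close>, so by minimality of the
  socle it only has to contain all images of \<open>Gamma J\<close>; these lie in the socle, which
  serves as \<open>N\<close> in \<open>Gamma_hom_image_torsion\<close>.\<close>

lemma socle_torsion: "socle (Gamma J) G \<subseteq> abelian_torsion J (G\<lparr>carrier := socle (Gamma J) G\<rparr>)"
  by (intro socle_minimal normal_abelian_torsion socle_normal Gamma_hom_image_torsion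
      hom_image_subset_socle)

lemma torsion_subset_socle:
  assumes "subgroup N G" "N \<subseteq> abelian_torsion J (G\<lparr>carrier := N\<rparr>)"
  shows "N \<subseteq> socle (Gamma J) G"
  using torsion_in_Gamma_hom_image[OF assms] hom_image_subset_socle by blast

lemma HZ_perfect_subgroup_iff:
  assumes "\<forall>p\<in>J. Factorial_Ring.prime p" "subgroup N G"
  shows "HZ_perfect J (G\<lparr>carrier := N\<rparr>) \<longleftrightarrow> N \<subseteq> abelian_torsion J (G\<lparr>carrier := N\<rparr>)"
  using group.HZ_perfect_iff[OF subgroup_imp_group[OF assms(2)] assms(1)] by simp

lemma maximal_normal_HZ_perfect_socle:
  assumes "\<forall>p\<in>J. Factorial_Ring.prime p"
  shows "is_maximal_normal_HZ_perfect J G (socle (Gamma J) G)"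
  unfolding is_maximal_normal_HZ_perfect_def
  using socle_normal[of "Gamma J"] socle_torsion[of J] torsion_subset_socle[of _ J]
    HZ_perfect_subgroup_iff[OF assms] normal_imp_subgroup by blast

text \<open>This is why dividing out the socle need not be iterated. The preimage \<open>P\<close>
  of the socle of the quotient is a torsion extension, hence contained in the socle of
  \<open>G\<close>, so the socle of the quotient is trivial and contains every image of
  \<open>Gamma J\<close>.\<close>

lemma trivial_hom_Mod_socle: "trivial_hom (Gamma J) (G Mod socle (Gamma J) G)"
  unfolding trivial_hom_def trivial_homomorphism_def
proof (intro ballI conjI)
  let ?S = "socle (Gamma J) G"
  let ?\<pi> = "\<lambda>x. ?S #> x"
  interpret S: normal ?S G by (rule socle_normal)
  interpret Q: group "G Mod ?S" by (rule S.factorgroup_is_group)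
  interpret \<pi>: group_hom G "G Mod ?S" ?\<pi>
    using S.r_coset_hom_Mod by unfold_locales
  let ?T = "socle (Gamma J) (G Mod ?S)"
  interpret T: normal ?T "G Mod ?S" by (rule Q.socle_normal)
  define P where "P = {x \<in> carrier G. ?\<pi> x \<in> ?T}"
  have P: "subgroup P G"
  proof (rule subgroupI)
    show "P \<noteq> {}" using \<pi>.hom_one T.one_closed unfolding P_def by force
  next
    fix x assume "x \<in> P"
    then show "inv x \<in> P" using \<pi>.hom_inv T.m_inv_closed unfolding P_def by force
  next
    fix x y assume "x \<in> P" "y \<in> P"
    then show "x \<otimes> y \<in> P" using \<pi>.hom_mult T.m_closed unfolding P_def by force
  qed (auto simp: P_def)
  have "?S \<subseteq> P"
  proof
    fix s assume s: "s \<in> ?S"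
    then have "?\<pi> s = \<one>\<^bsub>G Mod ?S\<^esub>"
      using coset_join2[OF _ S.subgroup_axioms s] by simp
    then show "s \<in> P" using s T.one_closed unfolding P_def by simp
  qed
  moreover have "?\<pi> ` P = ?T"
    using T.subset by (fastforce simp: P_def carrier_FactGroup)
  ultimately have "P \<subseteq> abelian_torsion J (G\<lparr>carrier := P\<rparr>)"
    using S.torsion_extension[OF P] socle_torsion Q.socle_torsion by simp
  then have PS: "P \<subseteq> ?S" by (rule torsion_subset_socle[OF P])
  fix h e assume h: "h \<in> hom (Gamma J) (G Mod ?S)"
  then show "h \<in> hom (Gamma J) (G Mod ?S)" .
  assume e: "e \<in> carrier (Gamma J)"
  obtain g where g: "g \<in> carrier G" "h e = ?\<pi> g"
    using hom_in_carrier[OF h e] by (auto simp: carrier_FactGroup)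
  have "h e \<in> ?T" using Q.hom_image_subset_socle[OF h] e by blast
  then have "g \<in> ?S" using PS g by (auto simp: P_def)
  then show "h e = \<one>\<^bsub>G Mod ?S\<^esub>"
    using g coset_join2[OF g(1) S.subgroup_axioms] by simp
qed

text \<open>Following a homomorphism to \<open>G\<close> by the projection to \<open>G Mod N\<close>
  gives a trivial homomorphism, so its image lies in \<open>N\<close>. This is the minimality
  required of the radical.\<close>

lemma socle_subset_if_trivial_hom_Mod:
  assumes N: "N \<lhd> G" and triv: "trivial_hom E (G Mod N)"
  shows "socle E G \<subseteq> N"
proof (rule socle_minimal[OF N])
  interpret N: normal N G by fact
  fix h assume h: "h \<in> hom E G"
  have "(\<lambda>x. N #> x) \<circ> h \<in> hom E (G Mod N)"
    by (rule Group.hom_compose[OF h N.r_coset_hom_Mod])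
  then have "N #> h e = N" if "e \<in> carrier E" for e
    using triv that unfolding trivial_hom_def trivial_homomorphism_def by auto
  then show "h ` carrier E \<subseteq> N"
    using coset_join1[OF _ _ N.subgroup_axioms] hom_in_carrier[OF h] by blast
qed

lemma radical_Gamma_eq_socle: "radical (Gamma J) G = socle (Gamma J) G"
proof -
  have "is_radical (Gamma J) G (socle (Gamma J) G)"
    using socle_normal trivial_hom_Mod_socle socle_subset_if_trivial_hom_Mod
    unfolding is_radical_def by blast
  then show ?thesis
    using is_radical_unique is_radical_radical[OF is_group] by blast
qed

end

theorem theorem2p7:
  fixes J :: "nat set" and G :: "('a, 'b) monoid_scheme"
  assumes "\<forall>p\<in>J. Factorial_Ring.prime p" and "group G"
  shows "is_maximal_normal_HZ_perfect J G (radical (Gamma J) G) \<and>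
         socle (Gamma J) G = radical (Gamma J) G \<and>
         nullification (Gamma J) G \<cong> G Mod socle (Gamma J) G"
  using group.maximal_normal_HZ_perfect_socle[OF assms(2,1)] iso_refl
  by (simp add: nullification_def group.radical_Gamma_eq_socle[OF assms(2)])

end
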